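(* Let $m\ge 2$ be an integer and let $G$ be a finite group. Then (groups being considered up to isomorphism): (1) $G$ is $m$CI if and only if either $m=2$ and $G=1$ or $G=\mathbb{Z}_3$, or $m\ge 3$ and $G=1$; (2) $G$ is $m$DCI if and only if $G=1$.
   Context: Digraphs are finite without loops or multiple arcs; a graph is a digraph with symmetric arc set. $V=\bigcup_{i=1}^m G_i$ is a disjoint union of copies $G_i=\{x_i:x\in G\}$ of $G$. For subsets $S_{i,j}\subseteq G$ ($1\le i,j\le m$) with $1\notin S_{i,i}$, the $m$-Cayley digraph $\mathrm{Cay}(G,S_{i,j}:1\le i,j\le m)$ has vertex set $V$ and arc set $\bigcup_{i,j}\{(x_i,(sx)_j): s\in S_{i,j},x\in G\}$; it is an $m$-Cayley graph if it is a graph. $R(G)=\{R(g):g\in G\}$ with $R(g):x_i\mapsto(xg)_i$ for all $x\in G$ and all $i$, and $N=N_{\mathrm{S}_V}(R(G))$ is its normalizer in the symmetric group on $V$. For a permutation $n$ of $V$, $\Gamma^n$ is the digraph with vertex set $V$ and arcs $(u^n,v^n)$ for $(u,v)$ an arc of $\Gamma$. An $m$-Cayley (di)graph $\Gamma$ of $G$ is $m$CI if for every $m$-Cayley (di)graph $\Sigma$ of $G$ isomorphic to $\Gamma$ there is $n\in N$ with $\Gamma^n=\Sigma$. The group $G$ is $m$DCI (resp. $m$CI) if every $m$-Cayley digraph (resp. $m$-Cayley graph) of $G$ is $m$CI. *)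

theory Defs
  imports
    "HOL-Algebra.Bij"
    "HOL-Algebra.Group_Action"
    "HOL-Algebra.Elementary_Groups"
    "Graph_Theory.Pair_Digraph"
    "Graph_Theory.Digraph_Isomorphism"
begin

text \<open>
  The vertex \<open>x\<^sub>i\<close>, i.e. the copy of \<open>x\<close> in the \<open>i\<close>-th copy of \<open>G\<close>, is the pair \<open>(x, i)\<close>.
  Digraphs are represented by \<^type>\<open>pair_pre_digraph\<close>, so multiple arcs are excluded by
  construction; lemma \<open>m_Cayley_digraph_pair_digraph\<close> below gives finiteness and absence of loops.
\<close>

definition copies :: "('a, 'b) monoid_scheme \<Rightarrow> nat \<Rightarrow> ('a \<times> nat) set" where
  "copies G m = carrier G \<times> {1..m}"

definition Cay :: "('a, 'b) monoid_scheme \<Rightarrow> nat \<Rightarrow> (nat \<Rightarrow> nat \<Rightarrow> 'a set) \<Rightarrow>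
    ('a \<times> nat) pair_pre_digraph" where
  "Cay G m S =
    \<lparr> pverts = copies G m,
      parcs = (\<Union>i\<in>{1..m}. \<Union>j\<in>{1..m}. {((x, i), (s \<otimes>\<^bsub>G\<^esub> x, j)) | s x. s \<in> S i j \<and> x \<in> carrier G}) \<rparr>"

definition m_Cayley_digraph ::
    "('a, 'b) monoid_scheme \<Rightarrow> nat \<Rightarrow> ('a \<times> nat) pair_pre_digraph \<Rightarrow> bool" where
  "m_Cayley_digraph G m \<Gamma> \<longleftrightarrow>
    (\<exists>S. (\<forall>i\<in>{1..m}. \<forall>j\<in>{1..m}. S i j \<subseteq> carrier G) \<and>
         (\<forall>i\<in>{1..m}. \<one>\<^bsub>G\<^esub> \<notin> S i i) \<and>
         \<Gamma> = Cay G m S)"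

definition m_Cayley_graph ::
    "('a, 'b) monoid_scheme \<Rightarrow> nat \<Rightarrow> ('a \<times> nat) pair_pre_digraph \<Rightarrow> bool" where
  "m_Cayley_graph G m \<Gamma> \<longleftrightarrow> m_Cayley_digraph G m \<Gamma> \<and> symmetric (with_proj \<Gamma>)"

text \<open>
  Permutations are elements of \<^const>\<open>BijGroup\<close>, whose product composes from right to left. With
  right actions the product would be the opposite one; this affects neither the set
  \<open>R_group G m\<close> nor its normalizer.
\<close>

definition R_perm :: "('a, 'b) monoid_scheme \<Rightarrow> nat \<Rightarrow> 'a \<Rightarrow> 'a \<times> nat \<Rightarrow> 'a \<times> nat" where
  "R_perm G m g = (\<lambda>(x, i) \<in> copies G m. (x \<otimes>\<^bsub>G\<^esub> g, i))"

definition R_group :: "('a, 'b) monoid_scheme \<Rightarrow> nat \<Rightarrow> ('a \<times> nat \<Rightarrow> 'a \<times> nat) set" where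
  "R_group G m = R_perm G m ` carrier G"

definition R_normalizer :: "('a, 'b) monoid_scheme \<Rightarrow> nat \<Rightarrow> ('a \<times> nat \<Rightarrow> 'a \<times> nat) set" where
  "R_normalizer G m = normalizer (BijGroup (copies G m)) (R_group G m)"

definition perm_digraph :: "('v \<Rightarrow> 'v) \<Rightarrow> 'v pair_pre_digraph \<Rightarrow> 'v pair_pre_digraph" where
  "perm_digraph n \<Gamma> = \<lparr> pverts = pverts \<Gamma>, parcs = {(n u, n v) | u v. (u, v) \<in> parcs \<Gamma>} \<rparr>"

definition mCI_digraph ::
    "('a, 'b) monoid_scheme \<Rightarrow> nat \<Rightarrow> ('a \<times> nat) pair_pre_digraph \<Rightarrow> bool" where
  "mCI_digraph G m \<Gamma> \<longleftrightarrow>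
    (\<forall>\<Sigma>. m_Cayley_digraph G m \<Sigma> \<and> digraph_iso (with_proj \<Gamma>) (with_proj \<Sigma>) \<longrightarrow>
         (\<exists>n\<in>R_normalizer G m. perm_digraph n \<Gamma> = \<Sigma>))"

definition mCI_graph ::
    "('a, 'b) monoid_scheme \<Rightarrow> nat \<Rightarrow> ('a \<times> nat) pair_pre_digraph \<Rightarrow> bool" where
  "mCI_graph G m \<Gamma> \<longleftrightarrow>
    (\<forall>\<Sigma>. m_Cayley_graph G m \<Sigma> \<and> digraph_iso (with_proj \<Gamma>) (with_proj \<Sigma>) \<longrightarrow>
         (\<exists>n\<in>R_normalizer G m. perm_digraph n \<Gamma> = \<Sigma>))"

definition mDCI_group :: "('a, 'b) monoid_scheme \<Rightarrow> nat \<Rightarrow> bool" where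
  "mDCI_group G m \<longleftrightarrow> (\<forall>\<Gamma>. m_Cayley_digraph G m \<Gamma> \<longrightarrow> mCI_digraph G m \<Gamma>)"

definition mCI_group :: "('a, 'b) monoid_scheme \<Rightarrow> nat \<Rightarrow> bool" where
  "mCI_group G m \<longleftrightarrow> (\<forall>\<Gamma>. m_Cayley_graph G m \<Gamma> \<longrightarrow> mCI_graph G m \<Gamma>)"

lemma m_Cayley_digraph_pair_digraph:
  assumes "group G" "finite (carrier G)" "m_Cayley_digraph G m \<Gamma>"
  shows "pair_digraph \<Gamma>"
proof -
  interpret group G by fact
  obtain S where S: "\<And>i j. i \<in> {1..m} \<Longrightarrow> j \<in> {1..m} \<Longrightarrow> S i j \<subseteq> carrier G"
    "\<And>i. i \<in> {1..m} \<Longrightarrow> \<one>\<^bsub>G\<^esub> \<notin> S i i" and \<Gamma>: "\<Gamma> = Cay G m S"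
    using assms(3) unfolding m_Cayley_digraph_def by blast
  have V: "pverts \<Gamma> = copies G m" "finite (copies G m)"
    using assms(2) by (auto simp: \<Gamma> Cay_def copies_def)
  have A: "parcs \<Gamma> \<subseteq> copies G m \<times> copies G m"
    using S(1) by (fastforce simp: \<Gamma> Cay_def copies_def)
  have L: "fst e \<noteq> snd e" if e: "e \<in> parcs \<Gamma>" for e
  proof
    assume eq: "fst e = snd e"
    obtain i j s x where *: "i \<in> {1..m}" "j \<in> {1..m}" "s \<in> S i j" "x \<in> carrier G"
      "e = ((x, i), (s \<otimes>\<^bsub>G\<^esub> x, j))"
      using e unfolding \<Gamma> Cay_def by auto
    with eq have "x = s \<otimes>\<^bsub>G\<^esub> x" "i = j" by auto
    moreover have "s \<in> carrier G" using S(1) * by blast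
    ultimately have "s = \<one>\<^bsub>G\<^esub>" using * l_cancel_one' by simp
    with S(2) * \<open>i = j\<close> show False by blast
  qed
  show ?thesis
    using A L V by unfold_locales (auto intro: finite_subset)
qed

lemma R_group_subset:
  assumes "group G"
  shows "R_group G m \<subseteq> carrier (BijGroup (copies G m))"
proof
  interpret group G by fact
  fix r assume "r \<in> R_group G m"
  then obtain g where g: "g \<in> carrier G" and r: "r = R_perm G m g"
    by (auto simp: R_group_def)
  have "bij_betw r (copies G m) (copies G m)"
    by (rule bij_betw_byWitness[where f' = "R_perm G m (inv\<^bsub>G\<^esub> g)"])
       (auto simp: r R_perm_def copies_def g m_assoc)
  moreover have "r \<in> extensional (copies G m)" by (simp add: r R_perm_def)
  ultimately show "r \<in> carrier (BijGroup (copies G m))" by (simp add: BijGroup_def Bij_def)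
qed

end

theory Submission
  imports Defs "HOL-Algebra.Multiplicative_Group"
begin

text \<open>
  A permutation \<open>n\<close> normalizing \<open>R(G)\<close> satisfies \<open>n R(g) = R(\<sigma> g) n\<close> for some map \<open>\<sigma>\<close>, so
  \<open>n\<close> permutes the copies of \<open>G\<close> and is given on the \<open>i\<close>-th copy by \<open>x\<^sub>i \<mapsto> (y\<^sub>i \<sigma>(x))\<^sub>j\<close>, where
  \<open>(y\<^sub>i)\<^sub>j\<close> is the image of \<open>1\<^sub>i\<close>. Two isomorphic \<open>m\<close>-Cayley graphs are therefore inequivalent
  as soon as they differ in something such maps preserve. Two constructions provide such pairs.

  \<^item> A subgroup \<open>H\<close> with \<open>1 < |H| \<le> m\<close> (lemma \<open>not_mCI_if_small_subgroup\<close>). A disjoint union of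
    complete graphs on \<open>|H|\<close> vertices can be placed with every clique inside one copy of \<open>G\<close>, as a
    coset of \<open>H\<close>, or with every clique meeting \<open>|H|\<close> different copies. Normalizing permutations
    preserve the partition into copies and cannot exchange the two placements.

  \<^item> Two connection sets \<open>A\<close> and \<open>B\<close> (lemma \<open>not_CI_by_coset_preserving_iso\<close>). Put \<open>A\<close> on both
    of the first two copies, or \<open>A\<close> on one and \<open>B\<close> on the other, and join the two copies by the
    connection set \<open>K\<close> for a subgroup \<open>K\<close>. The graphs are isomorphic when Cay(\<open>G\<close>, \<open>A\<close>) and
    Cay(\<open>G\<close>, \<open>B\<close>) are isomorphic by a map that fixes the right cosets of \<open>K\<close>, but a normalizing
    permutation between them forces \<open>A\<close> and \<open>B\<close> to be conjugate under \<open>K\<close>: the arcs in \<open>K\<close> tie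
    the two elements \<open>y\<^sub>i\<close> to the same coset of \<open>K\<close>.

  Together these exclude every nontrivial group, apart from the group of order three with two copies in
  the undirected case. An involution generates a subgroup \<open>H\<close> of order
  two. In a group without involutions, squaring is injective on \<open>K = \<langle>a\<rangle>\<close>, and the second
  construction applies to \<open>A = {a, a\<inverse>}\<close> and \<open>B = {a\<^sup>2, a\<^sup>-\<^sup>2}\<close> unless \<open>a\<^sup>3 = 1\<close>, and
  to \<open>A = {a}\<close> and \<open>B = {a\<^sup>2}\<close> without exception, which settles the directed case. There remain
  the groups of exponent three. If \<open>m \<ge> 3\<close>, a subgroup of order three serves as \<open>H\<close>. If \<open>m = 2\<close>
  and \<open>|G| > 3\<close>, counting conjugacy classes yields two nonconjugate subgroups of order three, and the
  second construction applies with \<open>K = G\<close>.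

  Conversely, for \<open>G = 1\<close> every permutation normalizes \<open>R(G)\<close>. For \<open>|G| = 3\<close> and \<open>m = 2\<close>, each
  copy carries either no edges or a triangle, and up to translating one copy against the other
  the edges between the copies are determined by their number. Degrees, together with the existence
  of a triangle, recover these data from the isomorphism type.
\<close>

section \<open>Isomorphisms of digraphs without parallel arcs\<close>

text \<open>
  Isomorphisms in the sense of \<^const>\<open>digraph_iso\<close> consist of a map on vertices and a map on arcs.
  When arcs are pairs of vertices, the former determines the latter.
\<close>

lemma digraph_iso_with_proj_iff:
  assumes "pair_wf_digraph \<Gamma>" and "pair_wf_digraph \<Sigma>"
  shows "digraph_iso (with_proj \<Gamma>) (with_proj \<Sigma>) \<longleftrightarrow>
    (\<exists>f. bij_betw f (pverts \<Gamma>) (pverts \<Sigma>) \<and>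
         (\<forall>u\<in>pverts \<Gamma>. \<forall>v\<in>pverts \<Gamma>. (u, v) \<in> parcs \<Gamma> \<longleftrightarrow> (f u, f v) \<in> parcs \<Sigma>))"
    (is "?iso \<longleftrightarrow> ?bij")
proof
  interpret \<Gamma>: pair_wf_digraph \<Gamma> by fact
  assume ?iso
  then obtain h where h: "pre_digraph.digraph_isomorphism (with_proj \<Gamma>) h"
    and \<Sigma>: "with_proj \<Sigma> = app_iso h (with_proj \<Gamma>)"
    unfolding digraph_iso_def by blast
  let ?f = "iso_verts h"
  have inj: "inj_on ?f (pverts \<Gamma>)"
    and ends: "\<And>e. e \<in> parcs \<Gamma> \<Longrightarrow> ?f (fst e) = iso_tail h (iso_arcs h e)"
      "\<And>e. e \<in> parcs \<Gamma> \<Longrightarrow> ?f (snd e) = iso_head h (iso_arcs h e)"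
    using h unfolding pre_digraph.digraph_isomorphism_def by auto
  have V: "pverts \<Sigma> = ?f ` pverts \<Gamma>" and E: "parcs \<Sigma> = iso_arcs h ` parcs \<Gamma>"
    and T: "iso_tail h = fst" and H: "iso_head h = snd"
    using \<Sigma> by (auto simp: with_proj_def app_iso_def)
  have arc: "iso_arcs h e = (?f (fst e), ?f (snd e))" if "e \<in> parcs \<Gamma>" for e
    using ends[OF that] by (simp add: T H prod_eq_iff)
  have "(u, v) \<in> parcs \<Gamma> \<longleftrightarrow> (?f u, ?f v) \<in> parcs \<Sigma>" if uv: "u \<in> pverts \<Gamma>" "v \<in> pverts \<Gamma>" for u v
  proof
    show "(u, v) \<in> parcs \<Gamma> \<Longrightarrow> (?f u, ?f v) \<in> parcs \<Sigma>"
      using arc[of "(u, v)"] by (auto simp: E intro: rev_image_eqI)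
    assume "(?f u, ?f v) \<in> parcs \<Sigma>"
    then obtain e where e: "e \<in> parcs \<Gamma>" "?f u = ?f (fst e)" "?f v = ?f (snd e)"
      using arc unfolding E by fastforce
    then show "(u, v) \<in> parcs \<Gamma>"
      using inj uv \<Gamma>.arc_fst_in_verts \<Gamma>.arc_snd_in_verts by (metis inj_onD prod.collapse)
  qed
  then show ?bij
    using inj by (intro exI[of _ ?f]) (simp add: V bij_betw_def)
next
  interpret \<Gamma>: pair_wf_digraph \<Gamma> by fact
  interpret \<Sigma>: pair_wf_digraph \<Sigma> by fact
  assume ?bij
  then obtain f where f: "bij_betw f (pverts \<Gamma>) (pverts \<Sigma>)"
    and arc: "\<And>u v. u \<in> pverts \<Gamma> \<Longrightarrow> v \<in> pverts \<Gamma> \<Longrightarrow> (u, v) \<in> parcs \<Gamma> \<longleftrightarrow> (f u, f v) \<in> parcs \<Sigma>"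
    by blast
  let ?h = "\<lparr> iso_verts = f, iso_arcs = map_prod f f, iso_head = snd, iso_tail = fst \<rparr>"
  have inj: "inj_on f (pverts \<Gamma>)" and V: "pverts \<Sigma> = f ` pverts \<Gamma>"
    using f by (auto simp: bij_betw_def)
  have sub: "parcs \<Gamma> \<subseteq> pverts \<Gamma> \<times> pverts \<Gamma>"
    by (auto dest: \<Gamma>.in_arcsD1 \<Gamma>.in_arcsD2)
  have "inj_on (map_prod f f) (parcs \<Gamma>)"
    using map_prod_inj_on[OF inj inj] sub by (rule inj_on_subset)
  then have "pre_digraph.digraph_isomorphism (with_proj \<Gamma>) ?h"
    using inj \<Gamma>.wf_digraph_axioms by (simp add: pre_digraph.digraph_isomorphism_def)
  moreover have "parcs \<Sigma> = map_prod f f ` parcs \<Gamma>"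
  proof
    show "map_prod f f ` parcs \<Gamma> \<subseteq> parcs \<Sigma>"
      using sub arc by auto
    show "parcs \<Sigma> \<subseteq> map_prod f f ` parcs \<Gamma>"
    proof
      fix e assume e: "e \<in> parcs \<Sigma>"
      then have "fst e \<in> f ` pverts \<Gamma>" "snd e \<in> f ` pverts \<Gamma>"
        using \<Sigma>.arc_fst_in_verts \<Sigma>.arc_snd_in_verts unfolding V by auto
      then obtain u v where "u \<in> pverts \<Gamma>" "v \<in> pverts \<Gamma>" "e = (f u, f v)"
        by (cases e) auto
      then show "e \<in> map_prod f f ` parcs \<Gamma>"
        using e arc by force
    qed
  qed
  then have "with_proj \<Sigma> = app_iso ?h (with_proj \<Gamma>)"
    by (simp add: with_proj_def app_iso_def V)
  ultimately show ?iso
    unfolding digraph_iso_def by blast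
qed

lemma symmetric_with_proj_iff:
  "symmetric (with_proj \<Gamma>) \<longleftrightarrow> (\<forall>u v. (u, v) \<in> parcs \<Gamma> \<longrightarrow> (v, u) \<in> parcs \<Gamma>)"
  by (auto simp: symmetric_def sym_def)

lemma perm_digraph_eqI:
  assumes "pair_wf_digraph \<Gamma>" and "pair_wf_digraph \<Sigma>"
    and V: "pverts \<Gamma> = pverts \<Sigma>" and n: "bij_betw n (pverts \<Sigma>) (pverts \<Sigma>)"
    and arc: "\<And>u v. u \<in> pverts \<Sigma> \<Longrightarrow> v \<in> pverts \<Sigma> \<Longrightarrow> (u, v) \<in> parcs \<Gamma> \<longleftrightarrow> (n u, n v) \<in> parcs \<Sigma>"
  shows "perm_digraph n \<Gamma> = \<Sigma>"
proof -
  interpret \<Gamma>: pair_wf_digraph \<Gamma> by fact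
  interpret \<Sigma>: pair_wf_digraph \<Sigma> by fact
  have "{(n u, n v) | u v. (u, v) \<in> parcs \<Gamma>} = parcs \<Sigma>"
  proof
    show "{(n u, n v) | u v. (u, v) \<in> parcs \<Gamma>} \<subseteq> parcs \<Sigma>"
      using arc \<Gamma>.in_arcsD1 \<Gamma>.in_arcsD2 unfolding V by blast
    show "parcs \<Sigma> \<subseteq> {(n u, n v) | u v. (u, v) \<in> parcs \<Gamma>}"
    proof
      fix e assume e: "e \<in> parcs \<Sigma>"
      then have "fst e \<in> n ` pverts \<Sigma>" "snd e \<in> n ` pverts \<Sigma>"
        using \<Sigma>.arc_fst_in_verts \<Sigma>.arc_snd_in_verts bij_betw_imp_surj_on[OF n] by simp_all
      then obtain u v where "u \<in> pverts \<Sigma>" "v \<in> pverts \<Sigma>" "e = (n u, n v)"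
        by (cases e) auto
      then show "e \<in> {(n u, n v) | u v. (u, v) \<in> parcs \<Gamma>}"
        using e arc by blast
    qed
  qed
  then show ?thesis
    using V by (simp add: perm_digraph_def)
qed

lemma iso_preserves_out_degree:
  assumes f: "bij_betw f V V"
    and arc: "\<And>u v. u \<in> V \<Longrightarrow> v \<in> V \<Longrightarrow> (u, v) \<in> A \<longleftrightarrow> (f u, f v) \<in> B"
    and u: "u \<in> V"
  shows "card {v \<in> V. (f u, v) \<in> B} = card {v \<in> V. (u, v) \<in> A}"
proof -
  have "{v \<in> V. (f u, v) \<in> B} = f ` {v \<in> V. (u, v) \<in> A}"
  proof
    show "f ` {v \<in> V. (u, v) \<in> A} \<subseteq> {v \<in> V. (f u, v) \<in> B}"
      using arc[OF u] bij_betw_apply[OF f] by blast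
    show "{v \<in> V. (f u, v) \<in> B} \<subseteq> f ` {v \<in> V. (u, v) \<in> A}"
    proof
      fix w assume w: "w \<in> {v \<in> V. (f u, v) \<in> B}"
      then obtain v where "v \<in> V" "w = f v"
        using bij_betw_imp_surj_on[OF f] by blast
      with w show "w \<in> f ` {v \<in> V. (u, v) \<in> A}"
        using arc[OF u] by blast
    qed
  qed
  moreover have "inj_on f {v \<in> V. (u, v) \<in> A}"
    using f by (auto simp: bij_betw_def intro: inj_on_subset)
  ultimately show ?thesis
    by (simp add: card_image)
qed

section \<open>Arcs of \<open>m\<close>-Cayley digraphs\<close>

context group
begin

lemma pair_wf_digraph_Cay:
  assumes "\<forall>i\<in>{1..m}. \<forall>j\<in>{1..m}. S i j \<subseteq> carrier G"
  shows "pair_wf_digraph (Cay G m S)"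
  using assms by unfold_locales (fastforce simp: Cay_def copies_def)+

lemma pverts_Cay [simp]: "pverts (Cay G m S) = copies G m"
  by (simp add: Cay_def)

lemma Cay_arc_iff:
  assumes "\<forall>i\<in>{1..m}. \<forall>j\<in>{1..m}. S i j \<subseteq> carrier G"
  shows "((x, i), (y, j)) \<in> parcs (Cay G m S) \<longleftrightarrow>
    (x, i) \<in> copies G m \<and> (y, j) \<in> copies G m \<and> y \<otimes> inv x \<in> S i j"
    (is "?arc \<longleftrightarrow> ?rhs")
proof
  assume ?arc
  then obtain s where s: "i \<in> {1..m}" "j \<in> {1..m}" "s \<in> S i j" "x \<in> carrier G" "y = s \<otimes> x"
    by (auto simp: Cay_def)
  moreover have "s \<in> carrier G"
    using assms s by blast
  ultimately show ?rhs
    by (simp add: copies_def m_assoc)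
next
  assume r: ?rhs
  then have "y = (y \<otimes> inv x) \<otimes> x"
    by (simp add: copies_def m_assoc)
  with r show ?arc
    by (fastforce simp: Cay_def copies_def)
qed

lemma m_Cayley_digraph_CayI:
  assumes "\<forall>i\<in>{1..m}. \<forall>j\<in>{1..m}. S i j \<subseteq> carrier G"
    and "\<And>i. i \<in> {1..m} \<Longrightarrow> \<one> \<notin> S i i"
  shows "m_Cayley_digraph G m (Cay G m S)"
  unfolding m_Cayley_digraph_def using assms by blast

lemma m_Cayley_graph_CayI:
  assumes S: "\<forall>i\<in>{1..m}. \<forall>j\<in>{1..m}. S i j \<subseteq> carrier G"
    and "\<And>i. i \<in> {1..m} \<Longrightarrow> \<one> \<notin> S i i"
    and inv: "\<And>i j s. i \<in> {1..m} \<Longrightarrow> j \<in> {1..m} \<Longrightarrow> s \<in> S i j \<Longrightarrow> inv s \<in> S j i"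
  shows "m_Cayley_graph G m (Cay G m S)"
proof -
  have "(v, u) \<in> parcs (Cay G m S)" if "(u, v) \<in> parcs (Cay G m S)" for u v
  proof -
    obtain x i y j where u: "u = (x, i)" and v: "v = (y, j)"
      by (cases u, cases v)
    have xy: "(x, i) \<in> copies G m" "(y, j) \<in> copies G m" "y \<otimes> inv x \<in> S i j"
      using that unfolding u v Cay_arc_iff[OF S] by auto
    then have "inv (y \<otimes> inv x) \<in> S j i"
      by (intro inv) (auto simp: copies_def)
    then show ?thesis
      using xy unfolding u v Cay_arc_iff[OF S]
      by (auto simp: copies_def inv_mult_group)
  qed
  then show ?thesis
    unfolding m_Cayley_graph_def symmetric_with_proj_iff
    using m_Cayley_digraph_CayI assms by blast
qed

text \<open>
  Symmetry of the arc set, read off at the vertices \<open>1\<^sub>i\<close>, says that inversion exchanges the connection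
  sets from \<open>i\<close> to \<open>j\<close> and from \<open>j\<close> to \<open>i\<close>.
\<close>

lemma m_Cayley_graph_obtain:
  assumes "m_Cayley_graph G m \<Gamma>"
  obtains S where "\<Gamma> = Cay G m S"
    and "\<forall>i\<in>{1..m}. \<forall>j\<in>{1..m}. S i j \<subseteq> carrier G"
    and "\<And>i. i \<in> {1..m} \<Longrightarrow> \<one> \<notin> S i i"
    and "\<And>i j s. i \<in> {1..m} \<Longrightarrow> j \<in> {1..m} \<Longrightarrow> s \<in> S i j \<Longrightarrow> inv s \<in> S j i"
proof -
  obtain S where \<Gamma>: "\<Gamma> = Cay G m S"
    and S: "\<forall>i\<in>{1..m}. \<forall>j\<in>{1..m}. S i j \<subseteq> carrier G"
    and one: "\<And>i. i \<in> {1..m} \<Longrightarrow> \<one> \<notin> S i i"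
    using assms unfolding m_Cayley_graph_def m_Cayley_digraph_def by blast
  have "inv s \<in> S j i" if "i \<in> {1..m}" "j \<in> {1..m}" "s \<in> S i j" for i j s
  proof -
    have "s \<in> carrier G"
      using that S by blast
    then have "((\<one>, i), (s, j)) \<in> parcs \<Gamma>"
      using that unfolding \<Gamma> Cay_arc_iff[OF S] by (simp add: copies_def)
    then have "((s, j), (\<one>, i)) \<in> parcs \<Gamma>"
      using assms unfolding m_Cayley_graph_def symmetric_with_proj_iff by blast
    then show ?thesis
      using \<open>s \<in> carrier G\<close> unfolding \<Gamma> Cay_arc_iff[OF S] by simp
  qed
  with that \<Gamma> S one show thesis by blast
qed

section \<open>The normalizer of \<open>R(G)\<close>\<close>

lemma R_perm_apply [simp]:
  "(x, i) \<in> copies G m \<Longrightarrow> R_perm G m g (x, i) = (x \<otimes> g, i)"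
  by (simp add: R_perm_def)

lemma R_normalizer_iff:
  "n \<in> R_normalizer G m \<longleftrightarrow> n \<in> Bij (copies G m) \<and>
    (n <#\<^bsub>BijGroup (copies G m)\<^esub> R_group G m) #>\<^bsub>BijGroup (copies G m)\<^esub>
      inv\<^bsub>BijGroup (copies G m)\<^esub> n = R_group G m"
  using R_group_subset[OF is_group, of m]
  by (auto simp: R_normalizer_def normalizer_def stabilizer_def BijGroup_def)

text \<open>
  Beside bijectivity, the inequivalence proofs use nothing else about normalizing permutations: with
  \<open>v = 1\<^sub>i\<close> it expresses \<open>n\<close> on the whole \<open>i\<close>-th copy by its value at \<open>1\<^sub>i\<close> and by \<open>\<sigma>\<close>.
\<close>

lemma R_normalizer_conj:
  assumes "n \<in> R_normalizer G m"
  obtains \<sigma> where "\<sigma> \<in> carrier G \<rightarrow> carrier G"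
    and "\<And>g v. g \<in> carrier G \<Longrightarrow> v \<in> copies G m \<Longrightarrow>
           n (R_perm G m g v) = R_perm G m (\<sigma> g) (n v)"
proof -
  let ?V = "copies G m" let ?B = "BijGroup ?V"
  interpret B: group ?B by (rule group_BijGroup)
  have n: "n \<in> carrier ?B"
    and eq: "(n <#\<^bsub>?B\<^esub> R_group G m) #>\<^bsub>?B\<^esub> inv\<^bsub>?B\<^esub> n = R_group G m"
    using assms by (auto simp: R_normalizer_iff BijGroup_def)
  have "\<exists>g'\<in>carrier G. \<forall>v\<in>?V. n (R_perm G m g v) = R_perm G m g' (n v)"
    if g: "g \<in> carrier G" for g
  proof -
    let ?r = "R_perm G m g"
    have r: "?r \<in> carrier ?B"
      using R_group_subset[OF is_group, of m] g by (auto simp: R_group_def)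
    have "n \<otimes>\<^bsub>?B\<^esub> ?r \<otimes>\<^bsub>?B\<^esub> inv\<^bsub>?B\<^esub> n
        \<in> (n <#\<^bsub>?B\<^esub> R_group G m) #>\<^bsub>?B\<^esub> inv\<^bsub>?B\<^esub> n"
      using g by (auto simp: l_coset_def r_coset_def R_group_def)
    then have "n \<otimes>\<^bsub>?B\<^esub> ?r \<otimes>\<^bsub>?B\<^esub> inv\<^bsub>?B\<^esub> n \<in> R_group G m"
      by (simp only: eq)
    then obtain g' where g': "g' \<in> carrier G"
      and *: "n \<otimes>\<^bsub>?B\<^esub> ?r \<otimes>\<^bsub>?B\<^esub> inv\<^bsub>?B\<^esub> n = R_perm G m g'"
      unfolding R_group_def by blast
    have r': "R_perm G m g' \<in> carrier ?B"
      using R_group_subset[OF is_group, of m] g' by (auto simp: R_group_def)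
    have "n \<otimes>\<^bsub>?B\<^esub> ?r = R_perm G m g' \<otimes>\<^bsub>?B\<^esub> n"
      using n r by (simp add: *[symmetric] B.m_assoc)
    then have "compose ?V n ?r = compose ?V (R_perm G m g') n"
      using n r r' by (simp add: BijGroup_def)
    then have "\<forall>v\<in>?V. n (?r v) = R_perm G m g' (n v)"
      by (metis compose_eq)
    with g' show ?thesis by blast
  qed
  then obtain \<sigma> where "\<forall>g\<in>carrier G. \<sigma> g \<in> carrier G \<and>
      (\<forall>v\<in>?V. n (R_perm G m g v) = R_perm G m (\<sigma> g) (n v))"
    by metis
  with that show thesis by blast
qed

text \<open>
  In the positive results the required permutations can even be found in the centralizer of \<open>R(G)\<close>.
\<close>

lemma R_normalizerI:
  assumes n: "n \<in> Bij (copies G m)"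
    and comm: "\<And>g v. g \<in> carrier G \<Longrightarrow> v \<in> copies G m \<Longrightarrow>
           n (R_perm G m g v) = R_perm G m g (n v)"
  shows "n \<in> R_normalizer G m"
proof -
  let ?V = "copies G m" let ?B = "BijGroup ?V"
  interpret B: group ?B by (rule group_BijGroup)
  have nB: "n \<in> carrier ?B"
    using n by (simp add: BijGroup_def)
  have conj: "n \<otimes>\<^bsub>?B\<^esub> r \<otimes>\<^bsub>?B\<^esub> inv\<^bsub>?B\<^esub> n = r" if r_in: "r \<in> R_group G m" for r
  proof -
    obtain g where g: "g \<in> carrier G" and r: "r = R_perm G m g"
      using r_in by (auto simp: R_group_def)
    have rB: "r \<in> carrier ?B"
      using R_group_subset[OF is_group, of m] r_in by blast
    have "compose ?V n r = compose ?V r n"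
      using comm[OF g] by (auto simp: compose_def r)
    then have "n \<otimes>\<^bsub>?B\<^esub> r = r \<otimes>\<^bsub>?B\<^esub> n"
      using nB rB by (simp add: BijGroup_def)
    then show ?thesis
      using nB rB by (simp add: B.m_assoc)
  qed
  then have "(n <#\<^bsub>?B\<^esub> R_group G m) #>\<^bsub>?B\<^esub> inv\<^bsub>?B\<^esub> n = R_group G m"
    by (auto simp: l_coset_def r_coset_def)
  with n show ?thesis
    by (simp add: R_normalizer_iff)
qed

section \<open>Isomorphic and equivalent pairs\<close>

lemma m_Cayley_digraph_wf:
  assumes "m_Cayley_digraph G m \<Gamma>"
  shows "pair_wf_digraph \<Gamma>" and "pverts \<Gamma> = copies G m"
  using assms pair_wf_digraph_Cay unfolding m_Cayley_digraph_def by fastforce+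

lemma m_Cayley_digraph_iso_iff:
  assumes "m_Cayley_digraph G m \<Gamma>" and "m_Cayley_digraph G m \<Sigma>"
  shows "digraph_iso (with_proj \<Gamma>) (with_proj \<Sigma>) \<longleftrightarrow>
    (\<exists>f. bij_betw f (copies G m) (copies G m) \<and>
         (\<forall>u\<in>copies G m. \<forall>v\<in>copies G m. (u, v) \<in> parcs \<Gamma> \<longleftrightarrow> (f u, f v) \<in> parcs \<Sigma>))"
  using digraph_iso_with_proj_iff m_Cayley_digraph_wf assms by metis

lemma perm_digraph_R_normalizer_arc_iff:
  assumes \<Gamma>: "m_Cayley_digraph G m \<Gamma>" and n: "n \<in> R_normalizer G m"
    and eq: "perm_digraph n \<Gamma> = \<Sigma>" and uv: "u \<in> copies G m" "v \<in> copies G m"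
  shows "(u, v) \<in> parcs \<Gamma> \<longleftrightarrow> (n u, n v) \<in> parcs \<Sigma>"
proof
  have \<Sigma>_arcs: "parcs \<Sigma> = {(n u, n v) | u v. (u, v) \<in> parcs \<Gamma>}"
    by (simp add: eq[symmetric] perm_digraph_def)
  show "(u, v) \<in> parcs \<Gamma> \<Longrightarrow> (n u, n v) \<in> parcs \<Sigma>"
    unfolding \<Sigma>_arcs by blast
  assume "(n u, n v) \<in> parcs \<Sigma>"
  then obtain u' v' where *: "(u', v') \<in> parcs \<Gamma>" "n u = n u'" "n v = n v'"
    unfolding \<Sigma>_arcs by blast
  interpret pair_wf_digraph \<Gamma> using \<Gamma> by (rule m_Cayley_digraph_wf)
  have "u' \<in> copies G m" "v' \<in> copies G m"
    using * in_arcsD1 in_arcsD2 m_Cayley_digraph_wf(2)[OF \<Gamma>] by blast+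
  moreover have "inj_on n (copies G m)"
    using n by (auto simp: R_normalizer_iff Bij_def bij_betw_def)
  ultimately show "(u, v) \<in> parcs \<Gamma>"
    using * uv by (metis inj_onD)
qed

lemma not_mDCI_groupI:
  assumes "m_Cayley_digraph G m \<Gamma>" "m_Cayley_digraph G m \<Sigma>"
    and "digraph_iso (with_proj \<Gamma>) (with_proj \<Sigma>)"
    and "\<And>n. n \<in> R_normalizer G m \<Longrightarrow> perm_digraph n \<Gamma> \<noteq> \<Sigma>"
  shows "\<not> mDCI_group G m"
  using assms unfolding mDCI_group_def mCI_digraph_def by blast

lemma not_mCI_groupI:
  assumes "m_Cayley_graph G m \<Gamma>" "m_Cayley_graph G m \<Sigma>"
    and "digraph_iso (with_proj \<Gamma>) (with_proj \<Sigma>)"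
    and "\<And>n. n \<in> R_normalizer G m \<Longrightarrow> perm_digraph n \<Gamma> \<noteq> \<Sigma>"
  shows "\<not> mCI_group G m"
  using assms unfolding mCI_group_def mCI_graph_def by blast

lemma mDCI_imp_mCI: "mDCI_group G m \<Longrightarrow> mCI_group G m"
  unfolding mDCI_group_def mCI_group_def mCI_digraph_def mCI_graph_def m_Cayley_graph_def
  by blast

section \<open>Cliques inside the copies and across the copies\<close>

text \<open>
  The choice is made from the coset and not from the element, so that all elements of a right coset
  of \<open>H\<close> get the same representative.
\<close>

definition coset_rep :: "'a set \<Rightarrow> 'a \<Rightarrow> 'a" where
  "coset_rep H x = (SOME y. y \<in> H #> x)"

lemma coset_rep:
  assumes H: "subgroup H G" and x: "x \<in> carrier G"
  shows "coset_rep H x \<in> carrier G" and "x \<otimes> inv (coset_rep H x) \<in> H"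
proof -
  interpret H: subgroup H G by fact
  have r: "coset_rep H x \<in> H #> x"
    unfolding coset_rep_def using rcos_self[OF x H] by (rule someI)
  then show c: "coset_rep H x \<in> carrier G"
    using H.elemrcos_carrier[OF is_group x] by blast
  have "coset_rep H x \<otimes> inv x \<in> H"
    using r H.rcos_module[OF is_group x c] by blast
  then have "inv (coset_rep H x \<otimes> inv x) \<in> H"
    by (rule H.m_inv_closed)
  then show "x \<otimes> inv (coset_rep H x) \<in> H"
    using c x by (simp add: inv_mult_group)
qed

lemma rcoset_eq_iff:
  assumes H: "subgroup H G" and x: "x \<in> carrier G" and y: "y \<in> carrier G"
  shows "H #> x = H #> y \<longleftrightarrow> y \<otimes> inv x \<in> H"
proof -
  interpret H: subgroup H G by fact
  show ?thesis
    using H.rcos_module[OF is_group x y] repr_independence[OF _ x H] rcos_self[OF y H] by blast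
qed

lemma coset_rep_eq_iff:
  assumes H: "subgroup H G" and x: "x \<in> carrier G" and y: "y \<in> carrier G"
  shows "coset_rep H x = coset_rep H y \<longleftrightarrow> y \<otimes> inv x \<in> H"
proof
  interpret H: subgroup H G by fact
  assume eq: "coset_rep H x = coset_rep H y"
  let ?r = "coset_rep H x"
  have "(y \<otimes> inv ?r) \<otimes> inv (x \<otimes> inv ?r) \<in> H"
    using coset_rep(2)[OF H x] coset_rep(2)[OF H y] by (simp add: eq)
  also have "(y \<otimes> inv ?r) \<otimes> inv (x \<otimes> inv ?r) = y \<otimes> inv x"
    using x y coset_rep(1)[OF H x] by (simp add: inv_mult_group m_assoc l_inv_ex) (simp add: m_assoc[symmetric])
  finally show "y \<otimes> inv x \<in> H" .
next
  assume "y \<otimes> inv x \<in> H"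
  then show "coset_rep H x = coset_rep H y"
    using rcoset_eq_iff[OF assms] by (simp add: coset_rep_def)
qed

lemma coset_rep_mult:
  assumes H: "subgroup H G" and h: "h \<in> H" and x: "x \<in> carrier G"
  shows "coset_rep H (h \<otimes> x) = coset_rep H x"
proof -
  have hG: "h \<in> carrier G"
    using H h by (rule subgroup.mem_carrier)
  then have "(h \<otimes> x) \<otimes> inv x \<in> H"
    using h x by (simp add: m_assoc)
  then show ?thesis
    using coset_rep_eq_iff[OF H x m_closed[OF hG x]] by metis
qed

lemma coset_rep_idem:
  assumes H: "subgroup H G" and x: "x \<in> carrier G"
  shows "coset_rep H (coset_rep H x) = coset_rep H x"
  using coset_rep_eq_iff[OF H coset_rep(1)[OF H x] x] coset_rep(2)[OF H x] by simp

text \<open>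
  Enumerate \<open>H\<close> as \<open>h\<^sub>1, \<dots>, h\<^sub>p\<close> and write each element of \<open>G\<close> as \<open>h\<^sub>j t\<close> with \<open>t\<close> the representative of
  its coset. Exchanging \<open>(h\<^sub>j t)\<^sub>i\<close> and \<open>(h\<^sub>i t)\<^sub>j\<close> on the first \<open>p\<close> copies is an involution that turns
  the cliques \<open>(H t)\<^sub>i\<close>, which lie inside the copies, into the cliques \<open>{x\<^sub>1, \<dots>, x\<^sub>p}\<close>, which meet
  each of these copies once. No permutation preserving the partition into copies does that.
\<close>

theorem not_mCI_if_small_subgroup:
  assumes H: "subgroup H G" and fin: "finite H" and nontriv: "H \<noteq> {\<one>}" and le: "card H \<le> m"
  shows "\<not> mCI_group G m"
proof -
  interpret H: subgroup H G by fact
  let ?V = "copies G m" let ?h = "card H" let ?r = "coset_rep H"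
  have h1: "1 \<le> ?h"
  proof -
    have "card H \<noteq> 0"
      using fin H.one_closed by (metis card_0_eq empty_iff)
    then show ?thesis by simp
  qed
  obtain e where e: "bij_betw e {1..?h} H"
    using ex_bij_betw_nat_finite_1[OF fin] by blast
  define k where "k = inv_into {1..?h} e"
  have e_H: "e i \<in> H" if "1 \<le> i" "i \<le> ?h" for i
    using e that by (auto simp: bij_betw_def)
  have k_in: "1 \<le> k z" "k z \<le> ?h" if "z \<in> H" for z
    using that bij_betw_apply[OF bij_betw_inv_into[OF e]] by (auto simp: k_def)
  have k_e: "k (e i) = i" if "1 \<le> i" "i \<le> ?h" for i
    using bij_betw_inv_into_left[OF e] that by (simp add: k_def)
  have e_k: "e (k z) = z" if "z \<in> H" for z
    using bij_betw_inv_into_right[OF e] that by (simp add: k_def)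
  define S where "S = (\<lambda>i j. if i = j \<and> i \<le> ?h then H - {\<one>} else {})"
  define T where "T = (\<lambda>i j. if i \<noteq> j \<and> i \<le> ?h \<and> j \<le> ?h then {\<one>} else {})"
  have S: "\<forall>i\<in>{1..m}. \<forall>j\<in>{1..m}. S i j \<subseteq> carrier G" and T: "\<forall>i\<in>{1..m}. \<forall>j\<in>{1..m}. T i j \<subseteq> carrier G"
    using H.subset by (auto simp: S_def T_def)
  have \<Gamma>: "m_Cayley_graph G m (Cay G m S)"
    using S by (rule m_Cayley_graph_CayI) (auto simp: S_def split: if_splits)
  have \<Sigma>: "m_Cayley_graph G m (Cay G m T)"
    using T by (rule m_Cayley_graph_CayI) (auto simp: T_def split: if_splits)
  (* With x = (e j) t this exchanges the vertices (e j) t in copy i and (e i) t in copy j. *)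
  define f where "f = (\<lambda>(x, i). if i \<le> ?h then (e i \<otimes> ?r x, k (x \<otimes> inv (?r x))) else (x, i))"
  have f_V: "f (x, i) \<in> ?V" and f_f: "f (f (x, i)) = (x, i)" if "(x, i) \<in> ?V" for x i
  proof -
    have x: "x \<in> carrier G" and i: "1 \<le> i" "i \<le> m"
      using that by (auto simp: copies_def)
    note r = coset_rep[OF H x]
    have rr: "?r (?r x) = ?r x"
      using coset_rep_idem[OF H x] .
    show "f (x, i) \<in> ?V"
      using x i r le e_H[of i] k_in[OF r(2)] H.mem_carrier by (auto simp: f_def copies_def)
    show "f (f (x, i)) = (x, i)"
    proof (cases "i \<le> ?h")
      case True
      have "?r (e i \<otimes> ?r x) = ?r x"
        using coset_rep_mult[OF H e_H[of i] r(1)] True i rr by simp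
      then show ?thesis
        using True i x r k_in[OF r(2)] e_H[of i] H.mem_carrier[OF e_H[of i]]
        by (simp add: f_def e_k k_e m_assoc)
    qed (simp add: f_def)
  qed
  have bij: "bij_betw f ?V ?V"
    by (rule bij_betw_byWitness[where f' = f]) (use f_V f_f in auto)
  have arc: "((x, i), (y, j)) \<in> parcs (Cay G m S) \<longleftrightarrow> (f (x, i), f (y, j)) \<in> parcs (Cay G m T)"
    if V: "(x, i) \<in> ?V" "(y, j) \<in> ?V" for x i y j
  proof -
    have x: "x \<in> carrier G" and y: "y \<in> carrier G" and i: "1 \<le> i" "i \<le> m" and j: "1 \<le> j" "j \<le> m"
      using V by (auto simp: copies_def)
    note rx = coset_rep[OF H x] and ry = coset_rep[OF H y]
    show ?thesis
    proof (cases "i \<le> ?h \<and> j \<le> ?h")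
      case True
      have eH: "e i \<in> H" "e j \<in> H"
        using True i j e_H by auto
      have eG: "e i \<in> carrier G" "e j \<in> carrier G"
        using eH H.mem_carrier by auto
      have same_fst: "e j \<otimes> ?r y = e i \<otimes> ?r x \<longleftrightarrow> i = j \<and> ?r x = ?r y"
      proof
        assume *: "e j \<otimes> ?r y = e i \<otimes> ?r x"
        have "?r (e i \<otimes> ?r x) = ?r x" "?r (e j \<otimes> ?r y) = ?r y"
          using coset_rep_mult[OF H] eH rx(1) ry(1) coset_rep_idem[OF H] x y by simp_all
        with * have r: "?r x = ?r y" by simp
        with * have "e j = e i"
          using eG rx by simp
        then have "i = j"
          using k_e True i j by metis
        with r show "i = j \<and> ?r x = ?r y" by simp
      qed simp
      have same_k: "k (x \<otimes> inv (?r x)) = k (y \<otimes> inv (?r y)) \<longleftrightarrow> x = y" if "?r x = ?r y"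
      proof
        assume "k (x \<otimes> inv (?r x)) = k (y \<otimes> inv (?r y))"
        then have "x \<otimes> inv (?r x) = y \<otimes> inv (?r y)"
          using e_k rx(2) ry(2) by metis
        then show "x = y"
          using that x y rx by simp
      qed simp
      have eq_one: "b \<otimes> inv a = \<one> \<longleftrightarrow> b = a" if "a \<in> carrier G" "b \<in> carrier G" for a b
        using that by (metis inv_equality inv_inv r_inv inv_closed)
      have "((x, i), (y, j)) \<in> parcs (Cay G m S) \<longleftrightarrow> i = j \<and> ?r x = ?r y \<and> x \<noteq> y"
        using True V coset_rep_eq_iff[OF H x y] eq_one[OF x y]
        unfolding Cay_arc_iff[OF S] by (simp add: S_def) blast
      moreover have "(f (x, i), f (y, j)) \<in> parcs (Cay G m T) \<longleftrightarrow>
          e j \<otimes> ?r y = e i \<otimes> ?r x \<and> k (x \<otimes> inv (?r x)) \<noteq> k (y \<otimes> inv (?r y))"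
      proof -
        have f_eq: "f (x, i) = (e i \<otimes> ?r x, k (x \<otimes> inv (?r x)))"
          "f (y, j) = (e j \<otimes> ?r y, k (y \<otimes> inv (?r y)))"
          using True by (simp_all add: f_def)
        show ?thesis
          using f_V[OF V(1)] f_V[OF V(2)] k_in[OF rx(2)] k_in[OF ry(2)]
            eq_one[OF m_closed[OF eG(1) rx(1)] m_closed[OF eG(2) ry(1)]]
          unfolding f_eq Cay_arc_iff[OF T] by (simp add: T_def)
      qed
      ultimately show ?thesis
        using same_fst same_k by metis
    next
      case False
      obtain x' i' y' j' where f_eq: "f (x, i) = (x', i')" "f (y, j) = (y', j')"
        by (cases "f (x, i)", cases "f (y, j)")
      then have "\<not> (i' \<le> ?h \<and> j' \<le> ?h)"
        using False by (auto simp: f_def split: if_splits)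
      then have "S i j = {}" "T i' j' = {}"
        using False by (auto simp: S_def T_def)
      then show ?thesis
        unfolding f_eq Cay_arc_iff[OF S] Cay_arc_iff[OF T] by simp
    qed
  qed
  have "digraph_iso (with_proj (Cay G m S)) (with_proj (Cay G m T))"
    using \<Gamma> \<Sigma> bij arc by (subst m_Cayley_digraph_iso_iff[of m]) (auto simp: m_Cayley_graph_def)
  moreover have "perm_digraph n (Cay G m S) \<noteq> Cay G m T" if n: "n \<in> R_normalizer G m" for n
  proof
    assume eq: "perm_digraph n (Cay G m S) = Cay G m T"
    obtain g where g: "g \<in> H" "g \<noteq> \<one>" "g \<in> carrier G"
      using nontriv H.one_closed H.subset by blast
    obtain \<sigma> where \<sigma>: "\<And>g v. g \<in> carrier G \<Longrightarrow> v \<in> ?V \<Longrightarrow>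
           n (R_perm G m g v) = R_perm G m (\<sigma> g) (n v)"
      using R_normalizer_conj[OF n] by metis
    have V: "(\<one>, 1) \<in> ?V" "(g, 1) \<in> ?V"
      using h1 le g by (auto simp: copies_def)
    have "n (\<one>, 1) \<in> ?V"
      using n V by (auto simp: R_normalizer_iff Bij_def bij_betw_def)
    then obtain y j where y: "n (\<one>, 1) = (y, j)" "(y, j) \<in> ?V"
      by (cases "n (\<one>, 1)") auto
    then have "n (g, 1) = (y \<otimes> \<sigma> g, j)"
      using \<sigma>[OF g(3) V(1)] V g by simp
    moreover have "((\<one>, 1), (g, 1)) \<in> parcs (Cay G m S)"
      using V g h1 unfolding Cay_arc_iff[OF S] by (simp add: S_def)
    moreover have "m_Cayley_digraph G m (Cay G m S)"
      using \<Gamma> by (simp add: m_Cayley_graph_def)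
    ultimately have "((y, j), (y \<otimes> \<sigma> g, j)) \<in> parcs (Cay G m T)"
      using perm_digraph_R_normalizer_arc_iff[OF _ n eq V] y by simp
    then show False
      unfolding Cay_arc_iff[OF T] by (simp add: T_def)
  qed
  ultimately show ?thesis
    using \<Gamma> \<Sigma> by (intro not_mCI_groupI)
qed

section \<open>Connection sets twisted on one of two copies\<close>

text \<open>
  The isomorphism is \<open>\<phi>\<close> on the second copy and the identity elsewhere; it respects the arcs between
  the first two copies because \<open>\<phi>\<close> fixes the right cosets of \<open>K\<close>.

  Suppose that a normalizing \<open>n\<close> maps the graph with \<open>A\<close> on both copies to the one with \<open>A\<close> and \<open>B\<close>. It
  maps two distinct copies \<open>i\<close> and \<open>j\<close> to the first and the second one. Comparing the arcs that leave
  \<open>1\<^sub>i\<close> and \<open>1\<^sub>j\<close> gives \<open>y\<^sub>i \<sigma>(A) y\<^sub>i\<inverse> = A\<close> and \<open>y\<^sub>j \<sigma>(A) y\<^sub>j\<inverse> = B\<close>, and the arc from \<open>1\<^sub>i\<close> to \<open>1\<^sub>j\<close>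
  gives \<open>y\<^sub>j = k y\<^sub>i\<close> with \<open>k \<in> K\<close>. Hence \<open>k A k\<inverse> = B\<close>.
\<close>

theorem not_CI_by_coset_preserving_iso:
  assumes finG: "finite (carrier G)" and m: "2 \<le> m"
    and K: "subgroup K G" and AG: "A \<subseteq> carrier G" and BG: "B \<subseteq> carrier G"
    and one: "\<one> \<notin> A" "\<one> \<notin> B"
    and \<phi>: "bij_betw \<phi> (carrier G) (carrier G)"
    and \<phi>_arc: "\<And>x y. x \<in> carrier G \<Longrightarrow> y \<in> carrier G \<Longrightarrow>
          y \<otimes> inv x \<in> A \<longleftrightarrow> \<phi> y \<otimes> inv (\<phi> x) \<in> B"
    and \<phi>_K: "\<And>x. x \<in> carrier G \<Longrightarrow> \<phi> x \<otimes> inv x \<in> K"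
    and not_conj: "\<And>k. k \<in> K \<Longrightarrow> \<exists>z\<in>A. k \<otimes> z \<otimes> inv k \<notin> B"
  shows "\<not> mDCI_group G m"
    and "(\<And>z. z \<in> A \<Longrightarrow> inv z \<in> A) \<Longrightarrow> (\<And>z. z \<in> B \<Longrightarrow> inv z \<in> B) \<Longrightarrow> \<not> mCI_group G m"
proof -
  interpret K: subgroup K G by fact
  let ?V = "copies G m"
  define S where "S = (\<lambda>i j::nat. if i \<in> {1, 2} \<and> j \<in> {1, 2} then if i = j then A else K else {})"
  define T where "T = (\<lambda>i j::nat. if i \<in> {1, 2} \<and> j \<in> {1, 2}
      then if i \<noteq> j then K else if i = 1 then A else B else {})"
  have S: "\<forall>i\<in>{1..m}. \<forall>j\<in>{1..m}. S i j \<subseteq> carrier G" and T: "\<forall>i\<in>{1..m}. \<forall>j\<in>{1..m}. T i j \<subseteq> carrier G"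
    using AG BG K.subset by (auto simp: S_def T_def)
  have \<Gamma>: "m_Cayley_digraph G m (Cay G m S)"
    using S by (rule m_Cayley_digraph_CayI) (auto simp: S_def one)
  have \<Sigma>: "m_Cayley_digraph G m (Cay G m T)"
    using T by (rule m_Cayley_digraph_CayI) (auto simp: T_def one)
  define f where "f = (\<lambda>(x, i::nat). (if i = 2 then \<phi> x else x, i))"
  have \<phi>G: "\<phi> x \<in> carrier G" if "x \<in> carrier G" for x
    using \<phi> that by (rule bij_betw_apply)
  have "inj_on f ?V"
  proof (rule inj_onI)
    fix u v assume "u \<in> ?V" "v \<in> ?V" "f u = f v"
    then show "u = v"
      using inj_onD[OF bij_betw_imp_inj_on[OF \<phi>], of "fst u" "fst v"]
      by (cases u, cases v) (simp add: f_def copies_def split: if_splits)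
  qed
  moreover have "f ` ?V \<subseteq> ?V"
  proof (rule image_subsetI)
    fix u assume "u \<in> ?V"
    then show "f u \<in> ?V"
      using \<phi>G[of "fst u"] by (cases u) (simp add: f_def copies_def)
  qed
  moreover have "finite ?V"
    using finG by (simp add: copies_def)
  ultimately have f: "bij_betw f ?V ?V"
    by (simp add: bij_betw_def endo_inj_surj)
  have K_left: "k \<otimes> z \<in> K \<longleftrightarrow> z \<in> K" if "k \<in> K" "z \<in> carrier G" for k z
  proof
    assume "k \<otimes> z \<in> K"
    then have "inv k \<otimes> (k \<otimes> z) \<in> K"
      using that by blast
    then show "z \<in> K"
      using that by (simp add: m_assoc[symmetric])
  qed (use that in blast)
  have K_right: "z \<otimes> inv k \<in> K \<longleftrightarrow> z \<in> K" if "k \<in> K" "z \<in> carrier G" for k z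
  proof
    assume "z \<otimes> inv k \<in> K"
    then have "(z \<otimes> inv k) \<otimes> k \<in> K"
      using that by blast
    then show "z \<in> K"
      using that by (simp add: m_assoc)
  qed (use that in blast)
  have \<phi>_left: "\<phi> y \<otimes> inv x \<in> K \<longleftrightarrow> y \<otimes> inv x \<in> K" if "x \<in> carrier G" "y \<in> carrier G" for x y
  proof -
    have "\<phi> y \<otimes> inv x = (\<phi> y \<otimes> inv y) \<otimes> (y \<otimes> inv x)"
      using that \<phi>G by (simp add: m_assoc) (simp add: m_assoc[symmetric])
    then show ?thesis
      using K_left \<phi>_K that by simp
  qed
  have \<phi>_right: "y \<otimes> inv (\<phi> x) \<in> K \<longleftrightarrow> y \<otimes> inv x \<in> K" if "x \<in> carrier G" "y \<in> carrier G" for x y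
  proof -
    have "y \<otimes> inv (\<phi> x) = (y \<otimes> inv x) \<otimes> inv (\<phi> x \<otimes> inv x)"
      using that \<phi>G by (simp add: inv_mult_group m_assoc) (simp add: m_assoc[symmetric])
    then show ?thesis
      using K_right \<phi>_K that by simp
  qed
  have arc: "((x, i), (y, j)) \<in> parcs (Cay G m S) \<longleftrightarrow> (f (x, i), f (y, j)) \<in> parcs (Cay G m T)"
    if V: "(x, i) \<in> ?V" "(y, j) \<in> ?V" for x i y j
  proof -
    have xy: "x \<in> carrier G" "y \<in> carrier G"
      using V by (auto simp: copies_def)
    have fV: "f (x, i) \<in> ?V" "f (y, j) \<in> ?V"
      using f V by (auto simp: bij_betw_def)
    consider "i \<notin> {1, 2} \<or> j \<notin> {1, 2}" | "i = 1" "j = 1" | "i = 2" "j = 2" | "i = 1" "j = 2" | "i = 2" "j = 1"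
      by blast
    then have "y \<otimes> inv x \<in> S i j \<longleftrightarrow> fst (f (y, j)) \<otimes> inv (fst (f (x, i))) \<in> T i j"
      by cases (auto simp: S_def T_def f_def \<phi>_arc[OF xy] \<phi>_left[OF xy] \<phi>_right[OF xy])
    then show ?thesis
      using V fV by (simp add: Cay_arc_iff[OF S] Cay_arc_iff[OF T] f_def)
  qed
  have iso: "digraph_iso (with_proj (Cay G m S)) (with_proj (Cay G m T))"
    using \<Gamma> \<Sigma> f arc by (subst m_Cayley_digraph_iso_iff[of m]) auto
  have neq: "perm_digraph n (Cay G m S) \<noteq> Cay G m T" if n: "n \<in> R_normalizer G m" for n
  proof
    assume eq: "perm_digraph n (Cay G m S) = Cay G m T"
    note n_arc = perm_digraph_R_normalizer_arc_iff[OF \<Gamma> n eq]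
    have n_bij: "bij_betw n ?V ?V"
      using n by (simp add: R_normalizer_iff Bij_def)
    obtain \<sigma> where \<sigma>G: "\<sigma> \<in> carrier G \<rightarrow> carrier G"
      and \<sigma>: "\<And>g v. g \<in> carrier G \<Longrightarrow> v \<in> ?V \<Longrightarrow> n (R_perm G m g v) = R_perm G m (\<sigma> g) (n v)"
      using R_normalizer_conj[OF n] by metis
    have base: "(\<one>, i) \<in> ?V" if "i \<in> {1, 2}" for i
      using that m by (auto simp: copies_def)
    define y where "y = (\<lambda>i. fst (n (\<one>, i)))"
    define \<pi> where "\<pi> = (\<lambda>i. snd (n (\<one>, i)))"
    have y\<pi>: "(y i, \<pi> i) \<in> ?V" "y i \<in> carrier G" "\<pi> i \<in> {1..m}" if "i \<in> {1, 2}" for i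
      using bij_betw_apply[OF n_bij base[OF that]] by (auto simp: y_def \<pi>_def copies_def split: prod.splits)
    have n_base: "n (\<one>, i) = (y i, \<pi> i)" for i
      by (simp add: y_def \<pi>_def)
    have n_eq: "n (x, i) = (y i \<otimes> \<sigma> x, \<pi> i)" if "i \<in> {1, 2}" "x \<in> carrier G" for i x
      using \<sigma>[OF that(2) base[OF that(1)]] y\<pi>(1)[OF that(1)] base[OF that(1)] that(2)
      by (simp add: n_base)
    have \<sigma>_one: "\<sigma> \<one> = \<one>"
    proof -
      have "y 1 \<otimes> \<sigma> \<one> = y 1"
        using n_eq[of 1 \<one>] n_base[of 1] by simp
      then show ?thesis
        using y\<pi>(2)[of 1] \<sigma>G by (simp add: funcset_mem r_cancel_one)
    qed
    have "inj_on \<sigma> (carrier G)"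
    proof (rule inj_onI)
      fix x x' assume x: "x \<in> carrier G" "x' \<in> carrier G" "\<sigma> x = \<sigma> x'"
      then have "n (x, 1) = n (x', 1)"
        by (simp add: n_eq)
      moreover have "(x, 1) \<in> ?V" "(x', 1) \<in> ?V"
        using x m by (auto simp: copies_def)
      ultimately show "x = x'"
        using n_bij by (auto simp: bij_betw_def dest: inj_onD)
    qed
    then have \<sigma>_surj: "\<sigma> ` carrier G = carrier G"
      using finG \<sigma>G by (intro endo_inj_surj) auto
    have "((\<one>, 1), (\<one>, 2)) \<in> parcs (Cay G m S)"
      using base unfolding Cay_arc_iff[OF S] by (simp add: S_def)
    then have "((y 1, \<pi> 1), (y 2, \<pi> 2)) \<in> parcs (Cay G m T)"
      using n_arc[of "(\<one>, 1)" "(\<one>, 2)"] base by (simp add: n_base)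
    then have \<pi>12: "\<pi> 1 \<in> {1, 2}" "\<pi> 2 \<in> {1, 2}"
      unfolding Cay_arc_iff[OF T] by (auto simp: T_def split: if_splits)
    (* If both copies went to the same one, a point of copy 1 would meet the image of \<one> in copy 2,
       because \<sigma> is onto. *)
    have "\<pi> 1 \<noteq> \<pi> 2"
    proof
      assume "\<pi> 1 = \<pi> 2"
      obtain x where x: "x \<in> carrier G" "\<sigma> x = inv (y 1) \<otimes> y 2"
        using \<sigma>_surj y\<pi>[of 1] y\<pi>[of 2] by (metis imageE insertI1 insert_commute inv_closed m_closed)
      then have "n (x, 1) = n (\<one>, 2)"
        using \<open>\<pi> 1 = \<pi> 2\<close> y\<pi>[of 1] y\<pi>[of 2] by (simp add: n_eq \<sigma>_one m_assoc[symmetric])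
      moreover have "(x, 1) \<in> ?V" "(\<one>, 2) \<in> ?V"
        using x m by (auto simp: copies_def)
      ultimately show False
        using n_bij by (auto simp: bij_betw_def dest: inj_onD)
    qed
    with \<pi>12 obtain i j where ij: "i \<in> {1, 2}" "j \<in> {1, 2}" "i \<noteq> j" "\<pi> i = 1" "\<pi> j = 2"
      by (metis insertE insertI1 insertI2 singletonD)
    have loop_arc: "z \<in> A \<longleftrightarrow> y l \<otimes> \<sigma> z \<otimes> inv (y l) \<in> T (\<pi> l) (\<pi> l)"
      if "l \<in> {1, 2}" "z \<in> carrier G" for l z
    proof -
      have V: "(\<one>, l) \<in> ?V" "(z, l) \<in> ?V"
        using that m by (auto simp: copies_def)
      have "n (\<one>, l) \<in> ?V" "n (z, l) \<in> ?V"
        using V bij_betw_apply[OF n_bij] by auto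
      then show ?thesis
        using n_arc[OF V] V that y\<pi>[OF that(1)]
        by (simp add: Cay_arc_iff[OF S] Cay_arc_iff[OF T] n_eq \<sigma>_one) (auto simp: S_def)
    qed
    have "((\<one>, i), (\<one>, j)) \<in> parcs (Cay G m S)"
      using base ij unfolding Cay_arc_iff[OF S] by (simp add: S_def)
    then have "((y i, \<pi> i), (y j, \<pi> j)) \<in> parcs (Cay G m T)"
      using n_arc[of "(\<one>, i)" "(\<one>, j)"] base ij by (simp only: n_base)
    then have k: "y j \<otimes> inv (y i) \<in> K" (is "?k \<in> K")
      using ij unfolding Cay_arc_iff[OF T] by (simp add: T_def)
    then obtain z where z: "z \<in> A" "?k \<otimes> z \<otimes> inv ?k \<notin> B"
      using not_conj by blast
    note yG = y\<pi>(2)[OF ij(1)] y\<pi>(2)[OF ij(2)]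
    have zG: "z \<in> carrier G"
      using z AG by blast
    have "inv (y i) \<otimes> z \<otimes> y i \<in> carrier G"
      using yG zG by simp
    then obtain x where x: "x \<in> carrier G" "\<sigma> x = inv (y i) \<otimes> z \<otimes> y i"
      using \<sigma>_surj by (metis imageE)
    have "y i \<otimes> \<sigma> x \<otimes> inv (y i) = z"
      using x yG zG by (simp add: m_assoc) (simp add: m_assoc[symmetric])
    then have "x \<in> A"
      using loop_arc[OF ij(1) x(1)] z(1) ij by (simp add: T_def)
    then have "y j \<otimes> \<sigma> x \<otimes> inv (y j) \<in> B"
      using loop_arc[OF ij(2) x(1)] ij by (simp add: T_def)
    moreover have "y j \<otimes> \<sigma> x \<otimes> inv (y j) = ?k \<otimes> z \<otimes> inv ?k"
      using x yG zG by (simp add: m_assoc inv_mult_group)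
    ultimately show False
      using z by simp
  qed
  show "\<not> mDCI_group G m"
    using \<Gamma> \<Sigma> iso neq by (rule not_mDCI_groupI)
  show "\<not> mCI_group G m" if inv: "\<And>z. z \<in> A \<Longrightarrow> inv z \<in> A" "\<And>z. z \<in> B \<Longrightarrow> inv z \<in> B"
  proof (rule not_mCI_groupI[OF _ _ iso neq])
    show "m_Cayley_graph G m (Cay G m S)"
      using S by (rule m_Cayley_graph_CayI) (auto simp: S_def one inv split: if_splits)
    show "m_Cayley_graph G m (Cay G m T)"
      using T by (rule m_Cayley_graph_CayI) (auto simp: T_def one inv split: if_splits)
  qed
qed

text \<open>
  Write \<open>x = h t\<close> with \<open>h \<in> K\<close> and \<open>t\<close> the representative of the coset \<open>K x\<close>. Then \<open>x \<mapsto> h\<^sup>2 t\<close> is a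
  bijection, since squaring is injective on the abelian group \<open>K\<close> in the absence of involutions, and it
  turns the arcs of \<open>z \<in> K\<close> into those of \<open>z\<^sup>2\<close>. Conjugation by elements of \<open>K\<close> is trivial on
  subsets of \<open>K\<close>, so \<open>A\<close> and its set of squares need only be different.
\<close>

theorem not_CI_by_squaring:
  assumes finG: "finite (carrier G)" and m: "2 \<le> m"
    and K: "subgroup K G" and comm: "\<And>x y. x \<in> K \<Longrightarrow> y \<in> K \<Longrightarrow> x \<otimes> y = y \<otimes> x"
    and no_inv: "\<And>t. t \<in> K \<Longrightarrow> t \<otimes> t = \<one> \<Longrightarrow> t = \<one>"
    and AK: "A \<subseteq> K" and one: "\<one> \<notin> A"
    and neq: "\<not> A \<subseteq> (\<lambda>z. z \<otimes> z) ` A"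
  shows "\<not> mDCI_group G m" and "(\<And>z. z \<in> A \<Longrightarrow> inv z \<in> A) \<Longrightarrow> \<not> mCI_group G m"
proof -
  interpret K: subgroup K G by fact
  let ?r = "coset_rep K" let ?B = "(\<lambda>z. z \<otimes> z) ` A"
  (* For x = h t with representative t, the value h x is h h t. *)
  define \<phi> where "\<phi> = (\<lambda>x. (x \<otimes> inv (?r x)) \<otimes> x)"
  have \<phi>G: "\<phi> x \<in> carrier G" if "x \<in> carrier G" for x
    using that coset_rep(1)[OF K that] by (simp add: \<phi>_def)
  have \<phi>_K: "\<phi> x \<otimes> inv x \<in> K" if "x \<in> carrier G" for x
    using that coset_rep[OF K that] by (simp add: \<phi>_def m_assoc)
  have \<phi>_mult: "\<phi> (z \<otimes> x) = z \<otimes> z \<otimes> \<phi> x" if z: "z \<in> K" and x: "x \<in> carrier G" for z x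
  proof -
    let ?h = "x \<otimes> inv (?r x)"
    have h: "?h \<in> K" by (rule coset_rep(2)[OF K x])
    have zh: "z \<in> carrier G" "?h \<in> carrier G"
      using z h K.mem_carrier by auto
    have "\<phi> (z \<otimes> x) = z \<otimes> (?h \<otimes> z) \<otimes> x"
      using z x zh coset_rep(1)[OF K x] by (simp add: \<phi>_def coset_rep_mult[OF K] m_assoc)
    also have "\<dots> = z \<otimes> (z \<otimes> ?h) \<otimes> x"
      using comm[OF h z] by simp
    also have "\<dots> = z \<otimes> z \<otimes> \<phi> x"
      using z x zh coset_rep(1)[OF K x] by (simp add: \<phi>_def m_assoc)
    finally show ?thesis .
  qed
  have sq_inj: "h = k" if "h \<in> K" "k \<in> K" "h \<otimes> h = k \<otimes> k" for h k
  proof -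
    have hk: "h \<in> carrier G" "k \<in> carrier G"
      using that K.mem_carrier by auto
    have "(h \<otimes> inv k) \<otimes> (h \<otimes> inv k) = h \<otimes> (inv k \<otimes> h) \<otimes> inv k"
      using hk by (simp add: m_assoc)
    also have "inv k \<otimes> h = h \<otimes> inv k"
      using that by (intro comm) auto
    also have "h \<otimes> (h \<otimes> inv k) \<otimes> inv k = (h \<otimes> h) \<otimes> inv (k \<otimes> k)"
      using hk by (simp add: m_assoc inv_mult_group)
    also have "\<dots> = \<one>"
      using that(3) hk by simp
    finally have sq: "(h \<otimes> inv k) \<otimes> (h \<otimes> inv k) = \<one>" .
    have "h \<otimes> inv k \<in> K"
      using that(1,2) by simp
    then have "h \<otimes> inv k = \<one>"
      using sq by (rule no_inv)
    then show "h = k"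
      using hk inv_equality[of h "inv k"] by simp
  qed
  have inj: "inj_on \<phi> (carrier G)"
  proof (rule inj_onI)
    fix x y assume xy: "x \<in> carrier G" "y \<in> carrier G" "\<phi> x = \<phi> y"
    let ?hx = "x \<otimes> inv (?r x)" let ?hy = "y \<otimes> inv (?r y)"
    have h: "?hx \<in> K" "?hy \<in> K"
      using coset_rep(2)[OF K] xy by auto
    have r: "?r (\<phi> x) = ?r x" "?r (\<phi> y) = ?r y"
      using coset_rep_mult[OF K h(1) xy(1)] coset_rep_mult[OF K h(2) xy(2)] by (simp_all add: \<phi>_def)
    then have eq: "?r x = ?r y"
      using xy by simp
    have "?hx \<otimes> ?hx = ?hy \<otimes> ?hy"
    proof -
      have "?hx \<otimes> ?hx = \<phi> x \<otimes> inv (?r x)" "?hy \<otimes> ?hy = \<phi> y \<otimes> inv (?r y)"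
        using xy(1,2) coset_rep(1)[OF K] by (simp_all add: \<phi>_def m_assoc)
      then show ?thesis
        by (simp only: xy(3) eq)
    qed
    then have "?hx = ?hy"
      using h sq_inj by blast
    then show "x = y"
      using xy eq coset_rep(1)[OF K] by simp
  qed
  have bij: "bij_betw \<phi> (carrier G) (carrier G)"
    using inj \<phi>G finG by (simp add: bij_betw_def endo_inj_surj image_subset_iff)
  have arc: "y \<otimes> inv x \<in> A \<longleftrightarrow> \<phi> y \<otimes> inv (\<phi> x) \<in> ?B" if xy: "x \<in> carrier G" "y \<in> carrier G" for x y
  proof
    have y: "y = (y \<otimes> inv x) \<otimes> x"
      using xy by (simp add: m_assoc)
    assume A: "y \<otimes> inv x \<in> A" (is "?z \<in> A")
    have "\<phi> y = ?z \<otimes> ?z \<otimes> \<phi> x"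
      using \<phi>_mult[of ?z x] A AK xy y by auto
    then have "\<phi> y \<otimes> inv (\<phi> x) = ?z \<otimes> ?z"
      using xy \<phi>G by (simp add: m_assoc)
    then show "\<phi> y \<otimes> inv (\<phi> x) \<in> ?B"
      using A by simp
  next
    assume "\<phi> y \<otimes> inv (\<phi> x) \<in> ?B"
    then obtain z where z: "z \<in> A" "\<phi> y \<otimes> inv (\<phi> x) = z \<otimes> z"
      by blast
    have zK: "z \<in> K" and zG: "z \<in> carrier G"
      using z AK K.mem_carrier by auto
    have "\<phi> y = (\<phi> y \<otimes> inv (\<phi> x)) \<otimes> \<phi> x"
      using xy \<phi>G by (simp add: m_assoc)
    also have "\<dots> = \<phi> (z \<otimes> x)"
      using z zK xy by (simp add: \<phi>_mult)
    finally have "y = z \<otimes> x"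
      using inj xy zG by (auto dest: inj_onD)
    then show "y \<otimes> inv x \<in> A"
      using z xy zG by (simp add: m_assoc)
  qed
  have not_conj: "\<exists>z\<in>A. k \<otimes> z \<otimes> inv k \<notin> ?B" if k: "k \<in> K" for k
  proof -
    obtain z where z: "z \<in> A" "z \<notin> ?B"
      using neq by blast
    have "k \<otimes> z = z \<otimes> k"
      using k z AK by (intro comm) auto
    then have "k \<otimes> z \<otimes> inv k = z"
      using k z AK K.mem_carrier by (simp add: m_assoc subset_iff)
    with z show ?thesis by metis
  qed
  have oneB: "\<one> \<notin> ?B"
  proof
    assume "\<one> \<in> ?B"
    then obtain z where z: "z \<in> A" "z \<otimes> z = \<one>"
      by force
    then have "z = \<one>"
      using AK no_inv[of z] by blast
    with z one show False by simp
  qed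
  have AG: "A \<subseteq> carrier G" and BG: "?B \<subseteq> carrier G"
    using AK K.subset by auto
  note result = not_CI_by_coset_preserving_iso[OF finG m K AG BG one oneB bij arc \<phi>_K not_conj]
  show "\<not> mDCI_group G m"
    by (rule result(1))
  show "\<not> mCI_group G m" if inv: "\<And>z. z \<in> A \<Longrightarrow> inv z \<in> A"
  proof (rule result(2))
    show "inv z \<in> ?B" if z_in: "z \<in> ?B" for z
    proof -
      obtain w where w: "w \<in> A" "z = w \<otimes> w"
        using z_in by blast
      have "w \<in> carrier G"
        using w(1) AG by blast
      then have "inv z = inv w \<otimes> inv w"
        using w(2) inv_mult_group[of w w] by simp
      then show ?thesis
        using inv[OF w(1)] by (rule image_eqI)
    qed
  qed (assumption | erule inv)+
qed

section \<open>Nonconjugate subgroups of equal order\<close>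

text \<open>
  The relation \<open>y x\<inverse> \<in> P\<close> partitions \<open>G\<close> into classes of the common size \<open>|P|\<close>; two such partitions
  with classes of the same size are matched by some bijection.
\<close>

lemma coset_matching_bij:
  assumes finG: "finite (carrier G)" and P: "subgroup P G" and Q: "subgroup Q G"
    and card: "card P = card Q"
  obtains \<phi> where "bij_betw \<phi> (carrier G) (carrier G)"
    and "\<And>x y. x \<in> carrier G \<Longrightarrow> y \<in> carrier G \<Longrightarrow> y \<otimes> inv x \<in> P \<longleftrightarrow> \<phi> y \<otimes> inv (\<phi> x) \<in> Q"
proof -
  have fin: "finite P" "finite Q"
    using P Q finG by (auto intro: finite_subset dest: subgroup.subset)
  have fin_cosets: "finite (rcosets P)" "finite (rcosets Q)"
    using finG P Q by (auto simp: RCOSETS_def)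
  have "card P \<noteq> 0"
    using fin(1) subgroup.one_closed[OF P] by (metis card_0_eq empty_iff)
  then have "card (rcosets P) = card (rcosets Q)"
    using lagrange[OF P] lagrange[OF Q] card by (metis mult_cancel2)
  then obtain F where F: "bij_betw F (rcosets P) (rcosets Q)"
    using fin_cosets finite_same_card_bij by blast
  have "\<exists>h. bij_betw h C (F C)" if C: "C \<in> rcosets P" for C
  proof -
    have FC: "F C \<in> rcosets Q"
      using F C by (rule bij_betw_apply)
    have "card C = card (F C)"
      using card_rcosets_equal[OF C] card_rcosets_equal[OF FC] P Q card
      by (simp add: subgroup.subset)
    moreover have "finite C" "finite (F C)"
      using C FC fin card_rcosets_equal[OF C] card_rcosets_equal[OF FC] P Q \<open>card P \<noteq> 0\<close> card
      by (metis card.infinite subgroup.subset)+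
    ultimately show ?thesis
      by (intro finite_same_card_bij)
  qed
  then obtain h where h: "\<And>C. C \<in> rcosets P \<Longrightarrow> bij_betw (h C) C (F C)"
    by metis
  define \<phi> where "\<phi> = (\<lambda>x. h (P #> x) x)"
  have cos: "P #> x \<in> rcosets P" if "x \<in> carrier G" for x
    using that P by (simp add: rcosetsI subgroup.subset)
  have in_F: "\<phi> x \<in> F (P #> x)" if "x \<in> carrier G" for x
    unfolding \<phi>_def using h[OF cos[OF that]] rcos_self[OF that P] by (rule bij_betw_apply)
  have FQ: "F (P #> x) \<in> rcosets Q" if "x \<in> carrier G" for x
    using F cos[OF that] by (rule bij_betw_apply)
  have \<phi>G: "\<phi> x \<in> carrier G" if "x \<in> carrier G" for x
    using in_F[OF that] FQ[OF that] subgroup.rcosets_carrier[OF Q is_group] by blast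
  have Q_coset: "Q #> \<phi> x = F (P #> x)" if x: "x \<in> carrier G" for x
  proof -
    obtain c where "c \<in> carrier G" "F (P #> x) = Q #> c"
      using FQ[OF x] by (auto simp: RCOSETS_def)
    then show ?thesis
      using repr_independence[OF _ _ Q] in_F[OF x] by auto
  qed
  have coset_eq: "P #> x = P #> y \<longleftrightarrow> Q #> \<phi> x = Q #> \<phi> y" if "x \<in> carrier G" "y \<in> carrier G" for x y
    using Q_coset that F cos by (auto simp: bij_betw_def dest: inj_onD)
  have "inj_on \<phi> (carrier G)"
  proof (rule inj_onI)
    fix x y assume xy: "x \<in> carrier G" "y \<in> carrier G" "\<phi> x = \<phi> y"
    then have "P #> x = P #> y"
      using coset_eq by simp
    then show "x = y"
      using xy h[OF cos[OF xy(1)]] rcos_self[OF xy(1) P] rcos_self[OF xy(2) P]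
      by (auto simp: \<phi>_def bij_betw_def dest: inj_onD)
  qed
  then have "bij_betw \<phi> (carrier G) (carrier G)"
    using \<phi>G finG by (simp add: bij_betw_def endo_inj_surj image_subset_iff)
  moreover have "y \<otimes> inv x \<in> P \<longleftrightarrow> \<phi> y \<otimes> inv (\<phi> x) \<in> Q" if "x \<in> carrier G" "y \<in> carrier G" for x y
    using coset_eq[OF that] rcoset_eq_iff[OF P that] rcoset_eq_iff[OF Q \<phi>G \<phi>G] that by simp
  ultimately show thesis by (rule that)
qed

text \<open>
  The connection sets \<open>P - {1}\<close> and \<open>Q - {1}\<close> both define disjoint unions of complete graphs on
  \<open>|P|\<close> vertices. Taking \<open>K = G\<close> imposes no condition on cosets.
\<close>

theorem not_mCI_if_nonconjugate_subgroups:
  assumes finG: "finite (carrier G)" and m: "2 \<le> m"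
    and P: "subgroup P G" and Q: "subgroup Q G" and card: "card P = card Q"
    and not_conj: "\<And>k. k \<in> carrier G \<Longrightarrow> \<exists>z\<in>P. k \<otimes> z \<otimes> inv k \<notin> Q"
  shows "\<not> mCI_group G m"
proof -
  interpret P: subgroup P G by fact
  interpret Q: subgroup Q G by fact
  obtain \<phi> where \<phi>: "bij_betw \<phi> (carrier G) (carrier G)"
    and arc: "\<And>x y. x \<in> carrier G \<Longrightarrow> y \<in> carrier G \<Longrightarrow>
                y \<otimes> inv x \<in> P \<longleftrightarrow> \<phi> y \<otimes> inv (\<phi> x) \<in> Q"
    using coset_matching_bij[OF finG P Q card] by metis
  have \<phi>G: "\<phi> x \<in> carrier G" if "x \<in> carrier G" for x
    using \<phi> that by (rule bij_betw_apply)
  have eq_one: "y \<otimes> inv x = \<one> \<longleftrightarrow> y = x" if "x \<in> carrier G" "y \<in> carrier G" for x y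
    using that by (metis inv_equality inv_inv r_inv inv_closed)
  have "y \<otimes> inv x \<in> P - {\<one>} \<longleftrightarrow> \<phi> y \<otimes> inv (\<phi> x) \<in> Q - {\<one>}"
    if xy: "x \<in> carrier G" "y \<in> carrier G" for x y
  proof -
    have "\<phi> y = \<phi> x \<longleftrightarrow> y = x"
      using \<phi> xy by (auto simp: bij_betw_def dest: inj_onD)
    then show ?thesis
      using arc[OF xy] eq_one[OF xy] eq_one[OF \<phi>G[OF xy(1)] \<phi>G[OF xy(2)]] by simp
  qed
  moreover have "\<exists>z\<in>P - {\<one>}. k \<otimes> z \<otimes> inv k \<notin> Q - {\<one>}" if k: "k \<in> carrier G" for k
  proof -
    obtain z where z: "z \<in> P" "k \<otimes> z \<otimes> inv k \<notin> Q"
      using not_conj[OF k] by blast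
    moreover have "z \<noteq> \<one>"
      using z k by auto
    ultimately show ?thesis by blast
  qed
  ultimately show ?thesis
    using \<phi> \<phi>G P.subset Q.subset
    by (intro not_CI_by_coset_preserving_iso(2)[OF finG m subgroup_self, of "P - {\<one>}" "Q - {\<one>}" \<phi>])
       (auto simp: inv_eq_1_iff)
qed

lemma conjugacy_class_card_dvd:
  assumes "a \<in> carrier G"
  shows "card ((\<lambda>g. g \<otimes> a \<otimes> inv g) ` carrier G) dvd order G"
proof -
  interpret group_action G "carrier G" "\<lambda>g. \<lambda>h\<in>carrier G. g \<otimes> h \<otimes> inv g"
    by (rule action_by_conjugation)
  have "orbit G (\<lambda>g. \<lambda>h\<in>carrier G. g \<otimes> h \<otimes> inv g) a = (\<lambda>g. g \<otimes> a \<otimes> inv g) ` carrier G"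
    using assms by (auto simp: orbit_def)
  then show ?thesis
    using orbit_stabilizer_theorem[OF assms] by (simp add: dvdI[OF sym])
qed

text \<open>
  Otherwise the classes of \<open>a\<close> and \<open>a\<inverse>\<close>, which have the same size \<open>c\<close> and are equal or disjoint,
  cover \<open>G - {1}\<close>. Then \<open>c\<close> divides both \<open>|G| - 1\<close> and \<open>|G|\<close>, so that \<open>c = 1\<close> and \<open>|G| \<le> 3\<close>.
\<close>

lemma exists_not_conjugate_up_to_inverse:
  assumes finG: "finite (carrier G)" and card: "3 < card (carrier G)"
    and a: "a \<in> carrier G" "a \<noteq> \<one>"
  obtains b where "b \<in> carrier G" and "b \<noteq> \<one>"
    and "\<And>k. k \<in> carrier G \<Longrightarrow> k \<otimes> a \<otimes> inv k \<noteq> b" and "\<And>k. k \<in> carrier G \<Longrightarrow> k \<otimes> a \<otimes> inv k \<noteq> inv b"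
proof (rule ccontr)
  assume no: "\<not> thesis"
  define C where "C = (\<lambda>c. (\<lambda>g. g \<otimes> c \<otimes> inv g) ` carrier G)"
  have CG: "C c \<subseteq> carrier G" if "c \<in> carrier G" for c
    using that by (auto simp: C_def)
  have inv_conj: "inv (g \<otimes> a \<otimes> inv g) = g \<otimes> inv a \<otimes> inv g" if "g \<in> carrier G" for g
    using that a by (simp add: inv_mult_group m_assoc)
  have C_inv: "C (inv a) = (\<lambda>x. inv x) ` C a"
    using inv_conj by (auto simp: C_def image_image)
  have cover: "carrier G - {\<one>} = C a \<union> C (inv a)"
  proof
    show "carrier G - {\<one>} \<subseteq> C a \<union> C (inv a)"
    proof
      fix b assume b: "b \<in> carrier G - {\<one>}"
      then have "\<exists>k\<in>carrier G. k \<otimes> a \<otimes> inv k = b \<or> k \<otimes> a \<otimes> inv k = inv b"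
        using no that[of b] by blast
      then obtain k where k: "k \<in> carrier G" "k \<otimes> a \<otimes> inv k = b \<or> k \<otimes> a \<otimes> inv k = inv b"
        by blast
      have "k \<otimes> a \<otimes> inv k \<in> C a"
        unfolding C_def using k(1) by (rule imageI)
      then have "b \<in> C a \<or> inv b \<in> C a"
        using k(2) by metis
      moreover have "b = inv (inv b)"
        using b by simp
      ultimately show "b \<in> C a \<union> C (inv a)"
        unfolding C_inv by blast
    qed
    have "g \<otimes> c \<otimes> inv g \<noteq> \<one>" if "g \<in> carrier G" "c \<in> carrier G" "c \<noteq> \<one>" for g c
      using that by (metis inv_closed inv_equality inv_inv l_cancel_one' m_closed r_cancel_one)
    then show "C a \<union> C (inv a) \<subseteq> carrier G - {\<one>}"
      using a CG[of a] CG[of "inv a"] by (auto simp: C_def inv_eq_1_iff)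
  qed
  have finC: "finite (C a)" "finite (C (inv a))"
    using finG by (auto simp: C_def)
  have card_C: "card (C (inv a)) = card (C a)"
    unfolding C_inv using CG[OF a(1)] by (intro card_image inj_onI) (metis inv_inv subsetD)
  have "card (C a) dvd card (C a \<union> C (inv a))"
  proof (cases "C a \<inter> C (inv a) = {}")
    case True
    then show ?thesis
      using finC card_C by (simp add: card_Un_disjoint)
  next
    case False
    then obtain g h where gh: "g \<in> carrier G" "h \<in> carrier G" "g \<otimes> a \<otimes> inv g = h \<otimes> inv a \<otimes> inv h"
      by (auto simp: C_def)
    define t where "t = inv h \<otimes> g"
    have t: "t \<in> carrier G"
      using gh by (simp add: t_def)
    have "t \<otimes> a \<otimes> inv t = inv h \<otimes> (g \<otimes> a \<otimes> inv g) \<otimes> h"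
      using gh(1,2) a by (simp add: t_def inv_mult_group m_assoc)
    also have "\<dots> = inv h \<otimes> (h \<otimes> inv a \<otimes> inv h) \<otimes> h"
      by (simp only: gh(3))
    also have "\<dots> = inv a"
      using gh(1,2) a by (simp add: m_assoc) (simp add: m_assoc[symmetric])
    finally have ta: "t \<otimes> a \<otimes> inv t = inv a" .
    have "C (inv a) \<subseteq> C a"
    proof
      fix x assume "x \<in> C (inv a)"
      then obtain g where g: "g \<in> carrier G" "x = g \<otimes> (t \<otimes> a \<otimes> inv t) \<otimes> inv g"
        by (auto simp: C_def ta)
      then have "x = (g \<otimes> t) \<otimes> a \<otimes> inv (g \<otimes> t)"
        using t a by (simp add: inv_mult_group m_assoc)
      then show "x \<in> C a"
        unfolding C_def by (rule image_eqI) (use g t in simp)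
    qed
    then show ?thesis
      by (simp add: Un_absorb2)
  qed
  then have dvd1: "card (C a) dvd card (carrier G) - 1"
    using finG by (simp add: cover[symmetric])
  have dvd2: "card (C a) dvd card (carrier G)"
    using conjugacy_class_card_dvd[OF a(1)] by (simp add: C_def order_def)
  have "card (C a) dvd 1"
    using dvd1 dvd2 card dvd_diff_nat[OF dvd2 dvd1] by simp
  then have "card (carrier G - {\<one>}) \<le> 2"
    using card_Un_le[of "C a" "C (inv a)"] card_C unfolding cover by simp
  then show False
    using finG card by simp
qed

section \<open>Nontrivial groups\<close>

lemma order_three_subgroup:
  assumes a: "a \<in> carrier G" "a \<noteq> \<one>" and cube: "a \<otimes> a \<otimes> a = \<one>"
  shows "inv a = a \<otimes> a" and "inv a \<noteq> a" and "subgroup {\<one>, a, inv a} G" and "card {\<one>, a, inv a} = 3"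
proof -
  show inv: "inv a = a \<otimes> a"
    using a cube by (intro inv_equality) auto
  show neq: "inv a \<noteq> a"
  proof
    assume "inv a = a"
    then have "a \<otimes> a = a"
      using inv by simp
    then show False
      using a by (simp add: r_cancel_one)
  qed
  have inv2: "inv a \<otimes> inv a = a"
  proof -
    have "inv a \<otimes> inv a = inv a \<otimes> (a \<otimes> a)"
      by (simp only: inv)
    then show ?thesis
      using a by (simp add: m_assoc[symmetric])
  qed
  show "subgroup {\<one>, a, inv a} G"
    by (rule subgroupI) (use a in \<open>auto simp: inv2 inv[symmetric]\<close>)
  have "\<one> \<noteq> inv a" "\<one> \<noteq> a" "a \<noteq> inv a"
    using a neq inv_eq_1_iff[OF a(1)] by metis+
  then show "card {\<one>, a, inv a} = 3"
    by simp
qed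

text \<open>
  The squares of \<open>{a}\<close> never form the same set, whereas \<open>{a, a\<inverse>}\<close> consists of its own squares
  exactly when \<open>a\<^sup>3 = 1\<close>. This is why directed and undirected graphs behave differently for the group
  of order three.
\<close>

lemma not_CI_if_no_involution:
  assumes finG: "finite (carrier G)" and m: "2 \<le> m"
    and no_inv: "\<And>t. t \<in> carrier G \<Longrightarrow> t \<otimes> t = \<one> \<Longrightarrow> t = \<one>"
    and a: "a \<in> carrier G" "a \<noteq> \<one>"
  shows "\<not> mDCI_group G m" and "a \<otimes> a \<otimes> a \<noteq> \<one> \<Longrightarrow> \<not> mCI_group G m"
proof -
  let ?K = "generate G {a}"
  have K: "subgroup ?K G"
    using a by (intro generate_is_subgroup) simp
  interpret K: subgroup ?K G by fact
  have comm: "x \<otimes> y = y \<otimes> x" if xy: "x \<in> ?K" "y \<in> ?K" for x y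
  proof -
    obtain i j :: int where "x = a [^] i" "y = a [^] j"
      using xy generate_pow[OF a(1)] by auto
    then show ?thesis
      using a by (simp add: int_pow_mult[symmetric] add.commute)
  qed
  have no_inv_K: "t = \<one>" if "t \<in> ?K" "t \<otimes> t = \<one>" for t
    using no_inv that K.mem_carrier by blast
  have aK: "a \<in> ?K"
    by (intro generate.incl) simp
  have aa: "a \<otimes> a \<noteq> a"
    using a by (simp add: r_cancel_one)
  show "\<not> mDCI_group G m"
  proof (rule not_CI_by_squaring(1)[OF finG m K comm no_inv_K, of "{a}"])
    show "\<not> {a} \<subseteq> (\<lambda>z. z \<otimes> z) ` {a}"
      using aa by auto
  qed (use a aK in simp_all)
  show "\<not> mCI_group G m" if cube: "a \<otimes> a \<otimes> a \<noteq> \<one>"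
  proof (rule not_CI_by_squaring(2)[OF finG m K comm no_inv_K, of "{a, inv a}"])
    have "a \<noteq> inv a \<otimes> inv a"
    proof
      assume "a = inv a \<otimes> inv a"
      then have "a \<otimes> a \<otimes> a = a \<otimes> a \<otimes> (inv a \<otimes> inv a)"
        by simp
      also have "\<dots> = \<one>"
        using a by (simp add: m_assoc) (simp add: m_assoc[symmetric])
      finally show False
        using cube by simp
    qed
    then show "\<not> {a, inv a} \<subseteq> (\<lambda>z. z \<otimes> z) ` {a, inv a}"
      using aa by auto
    show "\<one> \<notin> {a, inv a}"
      using a inv_eq_1_iff[OF a(1)] by (metis insertE singletonD)
  qed (use a aK in auto)
qed

theorem not_mCI_if_nontrivial:
  assumes finG: "finite (carrier G)" and m: "2 \<le> m" and nontriv: "carrier G \<noteq> {\<one>}"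
    and not_Z3: "\<not> (m = 2 \<and> card (carrier G) = 3)"
  shows "\<not> mCI_group G m"
proof -
  obtain a where a: "a \<in> carrier G" "a \<noteq> \<one>"
    using nontriv one_closed by blast
  consider t where "t \<in> carrier G" "t \<noteq> \<one>" "t \<otimes> t = \<one>"
    | c where "\<And>t. t \<in> carrier G \<Longrightarrow> t \<otimes> t = \<one> \<Longrightarrow> t = \<one>" "c \<in> carrier G" "c \<otimes> c \<otimes> c \<noteq> \<one>"
    | "\<And>t. t \<in> carrier G \<Longrightarrow> t \<otimes> t \<otimes> t = \<one>"
    by blast
  then show ?thesis
  proof cases
    case (1 t)
    have t_inv: "inv t = t"
      using 1 by (intro inv_equality) auto
    have "subgroup {\<one>, t} G"
      by (rule subgroupI) (use 1 t_inv in auto)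
    then show ?thesis
      using 1 m by (intro not_mCI_if_small_subgroup[of "{\<one>, t}"]) auto
  next
    case (2 c)
    then show ?thesis
      using not_CI_if_no_involution(2)[OF finG m 2(1), of c] by fastforce
  next
    case 3
    note P = order_three_subgroup[OF a 3[OF a(1)]]
    show ?thesis
    proof (cases "3 \<le> m")
      case True
      then show ?thesis
        using P a by (intro not_mCI_if_small_subgroup[OF P(3)]) auto
    next
      case False
      have "3 \<le> card (carrier G)"
        using card_mono[OF finG subgroup.subset[OF P(3)]] P(4) by simp
      then have "3 < card (carrier G)"
        using False m not_Z3 by linarith
      then obtain b where b: "b \<in> carrier G" "b \<noteq> \<one>"
        and not_conj: "\<And>k. k \<in> carrier G \<Longrightarrow> k \<otimes> a \<otimes> inv k \<noteq> b"
          "\<And>k. k \<in> carrier G \<Longrightarrow> k \<otimes> a \<otimes> inv k \<noteq> inv b"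
        using exists_not_conjugate_up_to_inverse[OF finG _ a] by metis
      note Q = order_three_subgroup[OF b 3[OF b(1)]]
      have "k \<otimes> a \<otimes> inv k \<noteq> \<one>" if "k \<in> carrier G" for k
      proof
        assume "k \<otimes> a \<otimes> inv k = \<one>"
        then have "k \<otimes> a = k"
          using that a inv_equality[of "k \<otimes> a" "inv k"] by simp
        then show False
          using that a by (simp add: r_cancel_one)
      qed
      then show ?thesis
        using not_conj P(4) Q(4)
        by (intro not_mCI_if_nonconjugate_subgroups[OF finG m P(3) Q(3)]) auto
    qed
  qed
qed

theorem not_mDCI_if_nontrivial:
  assumes finG: "finite (carrier G)" and m: "2 \<le> m" and nontriv: "carrier G \<noteq> {\<one>}"
  shows "\<not> mDCI_group G m"
proof (cases "m = 2 \<and> card (carrier G) = 3")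
  case False
  then show ?thesis
    using not_mCI_if_nontrivial[OF assms] mDCI_imp_mCI by blast
next
  case True
  obtain a where a: "a \<in> carrier G" "a \<noteq> \<one>"
    using nontriv one_closed by blast
  have "t = \<one>" if t: "t \<in> carrier G" "t \<otimes> t = \<one>" for t
  proof -
    have "t [^] (3::nat) = \<one>"
      using pow_order_eq_1[OF t(1)] True by (simp add: order_def)
    then show ?thesis
      using t by (simp add: numeral_3_eq_3)
  qed
  then show ?thesis
    using not_CI_if_no_involution(1)[OF finG m _ a] by blast
qed

section \<open>The trivial group\<close>

lemma mDCI_if_trivial:
  assumes triv: "carrier G = {\<one>}"
  shows "mDCI_group G m"
  unfolding mDCI_group_def mCI_digraph_def
proof (intro allI impI, elim conjE)
  fix \<Gamma> \<Sigma>
  let ?V = "copies G m"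
  assume \<Gamma>: "m_Cayley_digraph G m \<Gamma>" and \<Sigma>: "m_Cayley_digraph G m \<Sigma>"
    and "digraph_iso (with_proj \<Gamma>) (with_proj \<Sigma>)"
  then obtain f where f: "bij_betw f ?V ?V"
    and arc: "\<And>u v. u \<in> ?V \<Longrightarrow> v \<in> ?V \<Longrightarrow> (u, v) \<in> parcs \<Gamma> \<longleftrightarrow> (f u, f v) \<in> parcs \<Sigma>"
    using m_Cayley_digraph_iso_iff[OF \<Gamma> \<Sigma>] by blast
  let ?n = "restrict f ?V"
  have n: "?n \<in> Bij ?V"
    using f by (simp add: Bij_def bij_betw_restrict_eq)
  have fV: "f v \<in> ?V" if "v \<in> ?V" for v
    using f that by (rule bij_betw_apply)
  have R: "R_perm G m g v = v" if "g \<in> carrier G" "v \<in> ?V" for g v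
    using that triv by (cases v) (auto simp: copies_def)
  have "?n (R_perm G m g v) = R_perm G m g (?n v)" if g: "g \<in> carrier G" and v: "v \<in> ?V" for g v
    using R[OF g v] R[OF g fV[OF v]] v by simp
  with n have "?n \<in> R_normalizer G m"
    by (rule R_normalizerI)
  moreover have "perm_digraph ?n \<Gamma> = \<Sigma>"
    using m_Cayley_digraph_wf[OF \<Gamma>] m_Cayley_digraph_wf[OF \<Sigma>] n arc
    by (intro perm_digraph_eqI) (simp_all add: Bij_def)
  ultimately show "\<exists>n\<in>R_normalizer G m. perm_digraph n \<Gamma> = \<Sigma>"
    by blast
qed

section \<open>Equivalence by left translations\<close>

text \<open>
  Permuting the copies and multiplying each of them from the left by an element \<open>c\<^sub>i\<close> commutes with
  the right multiplications \<open>R(g)\<close>.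
\<close>

lemma Cay_equivalent_by_translations:
  assumes S: "\<forall>i\<in>{1..m}. \<forall>j\<in>{1..m}. S i j \<subseteq> carrier G"
    and T: "\<forall>i\<in>{1..m}. \<forall>j\<in>{1..m}. T i j \<subseteq> carrier G"
    and \<pi>: "bij_betw \<pi> {1..m} {1..m}" and c: "\<And>i. i \<in> {1..m} \<Longrightarrow> c i \<in> carrier G"
    and ST: "\<And>i j s. i \<in> {1..m} \<Longrightarrow> j \<in> {1..m} \<Longrightarrow> s \<in> carrier G \<Longrightarrow>
               s \<in> S i j \<longleftrightarrow> c j \<otimes> s \<otimes> inv (c i) \<in> T (\<pi> i) (\<pi> j)"
  shows "\<exists>n\<in>R_normalizer G m. perm_digraph n (Cay G m S) = Cay G m T"
proof -
  let ?V = "copies G m"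
  define n where "n = restrict (\<lambda>(x, i). (c i \<otimes> x, \<pi> i)) ?V"
  have n_apply: "n (x, i) = (c i \<otimes> x, \<pi> i)" if "(x, i) \<in> ?V" for x i
    using that by (simp add: n_def)
  have n_V: "(c i \<otimes> x, \<pi> i) \<in> ?V" if "(x, i) \<in> ?V" for x i
    using that c bij_betw_apply[OF \<pi>] by (simp add: copies_def)
  have inj: "inj_on n ?V"
  proof (rule inj_onI)
    fix u v assume u: "u \<in> ?V" and v: "v \<in> ?V" and eq: "n u = n v"
    obtain x i y j where uv: "u = (x, i)" "v = (y, j)"
      by (cases u, cases v)
    have "i = j"
      using eq u v bij_betw_imp_inj_on[OF \<pi>] unfolding uv
      by (auto simp: n_apply copies_def dest: inj_onD)
    then show "u = v"
      using eq u v c unfolding uv by (simp add: n_apply) (simp add: copies_def)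
  qed
  have surj: "n ` ?V = ?V"
  proof
    show "n ` ?V \<subseteq> ?V"
      using n_apply n_V by auto
    show "?V \<subseteq> n ` ?V"
    proof
      fix v assume v: "v \<in> ?V"
      obtain y j where yj: "v = (y, j)"
        by (cases v)
      with v have "j \<in> \<pi> ` {1..m}"
        using bij_betw_imp_surj_on[OF \<pi>] by (simp add: copies_def)
      then obtain i where i: "i \<in> {1..m}" "j = \<pi> i"
        by blast
      have "(inv (c i) \<otimes> y, i) \<in> ?V"
        using i v yj c by (simp add: copies_def)
      moreover have "n (inv (c i) \<otimes> y, i) = v"
        using calculation i v yj c by (simp add: n_apply) (simp add: copies_def m_assoc[symmetric])
      ultimately show "v \<in> n ` ?V"
        by (metis imageI)
    qed
  qed
  have bij: "bij_betw n ?V ?V"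
    using inj surj by (simp add: bij_betw_def)
  then have "n \<in> Bij ?V"
    by (simp add: Bij_def n_def)
  then have "n \<in> R_normalizer G m"
  proof (rule R_normalizerI)
    fix g v assume g: "g \<in> carrier G" and v: "v \<in> ?V"
    obtain x i where xi: "v = (x, i)"
      by (cases v)
    have "(x \<otimes> g, i) \<in> ?V"
      using g v xi by (simp add: copies_def)
    then show "n (R_perm G m g v) = R_perm G m g (n v)"
      using g v n_V[of x i] c unfolding xi by (simp add: n_apply) (simp add: copies_def m_assoc)
  qed
  moreover have "perm_digraph n (Cay G m S) = Cay G m T"
  proof (rule perm_digraph_eqI)
    show "(u, v) \<in> parcs (Cay G m S) \<longleftrightarrow> (n u, n v) \<in> parcs (Cay G m T)"
      if uv: "u \<in> pverts (Cay G m T)" "v \<in> pverts (Cay G m T)" for u v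
    proof -
      obtain x i y j where uv_eq: "u = (x, i)" "v = (y, j)"
        by (cases u, cases v)
      have V: "(x, i) \<in> ?V" "(y, j) \<in> ?V"
        using uv by (simp_all add: uv_eq)
      then have x: "x \<in> carrier G" "y \<in> carrier G" and i: "i \<in> {1..m}" "j \<in> {1..m}"
        by (auto simp: copies_def)
      have "(c j \<otimes> y) \<otimes> inv (c i \<otimes> x) = c j \<otimes> (y \<otimes> inv x) \<otimes> inv (c i)"
        using x c i by (simp add: inv_mult_group m_assoc)
      then show ?thesis
        using ST[OF i, of "y \<otimes> inv x"] x V n_V
        unfolding uv_eq n_apply[OF V(1)] n_apply[OF V(2)] Cay_arc_iff[OF S] Cay_arc_iff[OF T]
        by simp
    qed
  qed (use S T bij in \<open>simp_all add: pair_wf_digraph_Cay\<close>)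
  ultimately show ?thesis by blast
qed

section \<open>The group of order three with two copies\<close>

lemma out_degree_Cay_2:
  assumes S: "\<forall>i\<in>{1..2}. \<forall>j\<in>{1..2}. S i j \<subseteq> carrier G" and finG: "finite (carrier G)"
    and V: "(x, i) \<in> copies G 2"
  shows "card {v \<in> copies G 2. ((x, i), v) \<in> parcs (Cay G 2 S)} = card (S i 1) + card (S i 2)"
proof -
  have x: "x \<in> carrier G" and i: "i \<in> {1..2}"
    using V by (auto simp: copies_def)
  have sub: "S i j \<subseteq> carrier G" if "j \<in> {1, 2}" for j
  proof -
    have "j \<in> {1..2}"
      using that by auto
    then show ?thesis
      using S i by blast
  qed
  have fin: "finite (S i j)" if "j \<in> {1, 2}" for j
    using sub[OF that] finG by (rule finite_subset)
  let ?N = "\<lambda>j::nat. (\<lambda>s. (s \<otimes> x, j)) ` S i j"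
  have "{v \<in> copies G 2. ((x, i), v) \<in> parcs (Cay G 2 S)} = ?N 1 \<union> ?N 2"
  proof
    show "{v \<in> copies G 2. ((x, i), v) \<in> parcs (Cay G 2 S)} \<subseteq> ?N 1 \<union> ?N 2"
    proof
      fix v assume v: "v \<in> {v \<in> copies G 2. ((x, i), v) \<in> parcs (Cay G 2 S)}"
      obtain y j where yj: "v = (y, j)"
        by (cases v)
      have y: "y \<in> carrier G" "j = 1 \<or> j = 2" "y \<otimes> inv x \<in> S i j"
        using v unfolding yj by (auto simp: Cay_arc_iff[OF S] copies_def)
      then have "v = ((y \<otimes> inv x) \<otimes> x, j)"
        using x by (simp add: yj m_assoc)
      then have "v \<in> ?N j"
        using y(3) by (rule image_eqI)
      then show "v \<in> ?N 1 \<union> ?N 2"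
        using y(2) by auto
    qed
    have "?N j \<subseteq> {v \<in> copies G 2. ((x, i), v) \<in> parcs (Cay G 2 S)}" if j: "j \<in> {1, 2}" for j
    proof (rule image_subsetI)
      fix s assume s: "s \<in> S i j"
      then have "s \<in> carrier G"
        using sub[OF j] by blast
      then show "(s \<otimes> x, j) \<in> {v \<in> copies G 2. ((x, i), v) \<in> parcs (Cay G 2 S)}"
        using s x V j by (auto simp: Cay_arc_iff[OF S] copies_def m_assoc)
    qed
    from this[of 1] this[of 2]
    show "?N 1 \<union> ?N 2 \<subseteq> {v \<in> copies G 2. ((x, i), v) \<in> parcs (Cay G 2 S)}"
      by simp
  qed
  moreover have "card (?N j) = card (S i j)" if j: "j \<in> {1, 2}" for j
    using sub[OF j] x by (intro card_image inj_onI) (simp add: subset_iff)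
  moreover have "?N 1 \<inter> ?N 2 = {}"
    by auto
  ultimately show ?thesis
    using fin by (simp add: card_Un_disjoint)
qed

lemma cube_eq_one_if_card_3:
  assumes "card (carrier G) = 3" and "a \<in> carrier G"
  shows "a \<otimes> a \<otimes> a = \<one>"
proof -
  have "a [^] (3::nat) = \<one>"
    using pow_order_eq_1[OF assms(2)] assms(1) by (simp add: order_def)
  then show ?thesis
    using assms by (simp add: numeral_3_eq_3)
qed

lemma inverse_closed_card_3:
  assumes card: "card (carrier G) = 3" and S: "S \<subseteq> carrier G" "\<one> \<notin> S"
    and inv: "\<And>s. s \<in> S \<Longrightarrow> inv s \<in> S"
  shows "S = {} \<or> S = carrier G - {\<one>}"
proof (cases "S = {}")
  case False
  have fin: "finite (carrier G)"
    using card by (metis card.infinite zero_neq_numeral)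
  obtain s where s: "s \<in> S"
    using False by blast
  then have sG: "s \<in> carrier G" "s \<noteq> \<one>"
    using S by auto
  note P = order_three_subgroup[OF sG cube_eq_one_if_card_3[OF card sG(1)]]
  have "{\<one>, s, inv s} = carrier G"
    using fin subgroup.subset[OF P(3)] P(4) card by (intro card_subset_eq) auto
  moreover have "{s, inv s} \<subseteq> S"
    using s inv by auto
  ultimately show ?thesis
    using S by auto
qed simp

text \<open>
  A nonempty proper subset of a set with three elements is a singleton or the complement of one, and
  left translations act transitively on singletons.
\<close>

lemma translate_if_card_eq:
  assumes card: "card (carrier G) = 3" and T: "T \<subseteq> carrier G" "T' \<subseteq> carrier G" "card T = card T'"
  obtains c where "c \<in> carrier G" and "\<And>x. x \<in> carrier G \<Longrightarrow> x \<in> T \<longleftrightarrow> c \<otimes> x \<in> T'"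
proof -
  have fin: "finite (carrier G)"
    using card by (metis card.infinite zero_neq_numeral)
  then have finT: "finite T" "finite T'"
    using T finite_subset by blast+
  have single: "\<exists>c\<in>carrier G. \<forall>x\<in>carrier G. x \<in> U \<longleftrightarrow> c \<otimes> x \<in> U'"
    if U: "U \<subseteq> carrier G" "U' \<subseteq> carrier G" "card U = 1" "card U' = 1" for U U'
  proof -
    obtain u u' where u: "U = {u}" "U' = {u'}"
      using U card_1_singletonE by metis
    have uG: "u \<in> carrier G" "u' \<in> carrier G"
      using U u by auto
    have "x = u \<longleftrightarrow> u' \<otimes> inv u \<otimes> x = u'" if x: "x \<in> carrier G" for x
    proof
      show "x = u \<Longrightarrow> u' \<otimes> inv u \<otimes> x = u'"
        using uG by (simp add: m_assoc)
      assume "u' \<otimes> inv u \<otimes> x = u'"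
      then have "inv u \<otimes> x = \<one>"
        using uG x by (simp add: m_assoc r_cancel_one)
      then have "inv x = inv u"
        using uG x by (intro inv_equality) simp_all
      then show "x = u"
        using uG x by (metis inv_inv)
    qed
    then show ?thesis
      using uG unfolding u by (intro bexI[of _ "u' \<otimes> inv u"]) auto
  qed
  have "card T \<le> 3"
    using card_mono[OF fin T(1)] card by simp
  then consider "card T = 0" | "card T = 1" | "card T = 2" | "card T = 3"
    by linarith
  then have "\<exists>c\<in>carrier G. \<forall>x\<in>carrier G. x \<in> T \<longleftrightarrow> c \<otimes> x \<in> T'"
  proof cases
    case 1
    then have "T = {}" "T' = {}"
      using finT T(3) by auto
    then show ?thesis by auto
  next
    case 2
    then show ?thesis
      using single[OF T(1,2)] T(3) by simp
  next
    case 3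
    have "card (carrier G - T) = 1" "card (carrier G - T') = 1"
      using 3 T finT fin card by (simp_all add: card_Diff_subset)
    then obtain c where c: "c \<in> carrier G"
      and *: "\<forall>x\<in>carrier G. x \<in> carrier G - T \<longleftrightarrow> c \<otimes> x \<in> carrier G - T'"
      using single[of "carrier G - T" "carrier G - T'"] by auto
    have "\<forall>x\<in>carrier G. x \<in> T \<longleftrightarrow> c \<otimes> x \<in> T'"
      using * c by simp
    then show ?thesis
      using c by blast
  next
    case 4
    then have "T = carrier G" "T' = carrier G"
      using T card card_subset_eq[OF fin T(1)] card_subset_eq[OF fin T(2)] by simp_all
    then show ?thesis
      by (intro bexI[of _ \<one>]) auto
  qed
  with that show thesis by blast
qed

text \<open>
  Degrees alone do not separate two triangles joined by \<open>3 k\<close> edges from a bipartite graph with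
  \<open>3 (k + 2)\<close> edges; for instance both the prism and the complete bipartite graph on three and three vertices
  are cubic. The triangle does: an arc of the second graph always changes the copy, so three
  mutually adjacent vertices would need three copies.
\<close>

lemma triangle_not_bipartite:
  assumes card: "card (carrier G) = 3"
    and S: "\<forall>i\<in>{1..2}. \<forall>j\<in>{1..2}. S i j \<subseteq> carrier G" and T: "\<forall>i\<in>{1..2}. \<forall>j\<in>{1..2}. T i j \<subseteq> carrier G"
    and S11: "S 1 1 = carrier G - {\<one>}" and T_loop: "T 1 1 = {}" "T 2 2 = {}"
    and fV: "\<And>v. v \<in> copies G 2 \<Longrightarrow> f v \<in> copies G 2"
    and arc: "\<And>u v. u \<in> copies G 2 \<Longrightarrow> v \<in> copies G 2 \<Longrightarrow>
                (u, v) \<in> parcs (Cay G 2 S) \<Longrightarrow> (f u, f v) \<in> parcs (Cay G 2 T)"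
  shows False
proof -
  have fin: "finite (carrier G)"
    using card by (metis card.infinite zero_neq_numeral)
  have "carrier G \<noteq> {\<one>}"
    using card by auto
  then obtain a where a: "a \<in> carrier G" "a \<noteq> \<one>"
    using one_closed by blast
  note P = order_three_subgroup[OF a cube_eq_one_if_card_3[OF card a(1)]]
  have V: "(x, 1) \<in> copies G 2" if "x \<in> carrier G" for x
    using that by (simp add: copies_def)
  have neq: "snd (f (x, 1)) \<noteq> snd (f (y, 1))" if xy: "x \<in> carrier G" "y \<in> carrier G" "x \<noteq> y" for x y
  proof -
    have "y \<otimes> inv x \<noteq> \<one>"
      using xy by (metis inv_equality inv_inv inv_closed)
    then have "((x, 1), (y, 1)) \<in> parcs (Cay G 2 S)"
      using xy V unfolding Cay_arc_iff[OF S] by (simp add: S11 del: One_nat_def)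
    then have "(f (x, 1), f (y, 1)) \<in> parcs (Cay G 2 T)"
      using xy V by (intro arc)
    moreover obtain x' i y' j where f: "f (x, 1) = (x', i)" "f (y, 1) = (y', j)"
      by (cases "f (x, 1)", cases "f (y, 1)")
    ultimately have "y' \<otimes> inv x' \<in> T i j"
      unfolding f Cay_arc_iff[OF T] by simp
    moreover have "i = 1 \<or> i = 2"
      using fV[OF V[OF xy(1)]] f by (auto simp: copies_def)
    ultimately show ?thesis
      using T_loop f by auto
  qed
  have range: "snd (f (x, 1)) \<in> {1, 2}" if "x \<in> carrier G" for x
    using fV[OF V[OF that]] by (cases "f (x, 1)") (auto simp: copies_def)
  have "\<one> \<noteq> inv a"
    using a inv_eq_1_iff[OF a(1)] by metis
  then show False
    using neq[of \<one> a] neq[of a "inv a"] neq[of \<one> "inv a"] range[of \<one>] range[of a] range[of "inv a"] a P(2)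
    by auto
qed

text \<open>
  The connection set from a copy to itself is empty or all of \<open>G - {1}\<close>. The degrees, on both copies,
  leave as the only ambiguity the one excluded by \<open>triangle_not_bipartite\<close>. So after possibly exchanging
  the copies, the two graphs agree inside each copy, and their connection sets between the copies
  have equal size and are therefore left translates of each other.
\<close>

theorem mCI_if_card_3:
  assumes card: "card (carrier G) = 3"
  shows "mCI_group G 2"
  unfolding mCI_group_def mCI_graph_def
proof (intro allI impI, elim conjE)
  fix \<Gamma> \<Sigma>
  let ?V = "copies G 2"
  assume \<Gamma>: "m_Cayley_graph G 2 \<Gamma>" and \<Sigma>: "m_Cayley_graph G 2 \<Sigma>"
    and iso: "digraph_iso (with_proj \<Gamma>) (with_proj \<Sigma>)"
  have fin: "finite (carrier G)"
    using card by (metis card.infinite zero_neq_numeral)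
  obtain S where \<Gamma>_eq: "\<Gamma> = Cay G 2 S" and S: "\<forall>i\<in>{1..2}. \<forall>j\<in>{1..2}. S i j \<subseteq> carrier G"
    and S_one: "\<And>i. i \<in> {1..2} \<Longrightarrow> \<one> \<notin> S i i"
    and S_inv: "\<And>i j s. i \<in> {1..2} \<Longrightarrow> j \<in> {1..2} \<Longrightarrow> s \<in> S i j \<Longrightarrow> inv s \<in> S j i"
    using m_Cayley_graph_obtain[OF \<Gamma>] by metis
  obtain T where \<Sigma>_eq: "\<Sigma> = Cay G 2 T" and T: "\<forall>i\<in>{1..2}. \<forall>j\<in>{1..2}. T i j \<subseteq> carrier G"
    and T_one: "\<And>i. i \<in> {1..2} \<Longrightarrow> \<one> \<notin> T i i"
    and T_inv: "\<And>i j s. i \<in> {1..2} \<Longrightarrow> j \<in> {1..2} \<Longrightarrow> s \<in> T i j \<Longrightarrow> inv s \<in> T j i"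
    using m_Cayley_graph_obtain[OF \<Sigma>] by metis
  obtain f where f: "bij_betw f ?V ?V"
    and arc: "\<And>u v. u \<in> ?V \<Longrightarrow> v \<in> ?V \<Longrightarrow> (u, v) \<in> parcs (Cay G 2 S) \<longleftrightarrow> (f u, f v) \<in> parcs (Cay G 2 T)"
    using iso \<Gamma> \<Sigma> m_Cayley_digraph_iso_iff[of 2 \<Gamma> \<Sigma>] unfolding m_Cayley_graph_def \<Gamma>_eq \<Sigma>_eq by blast
  have loops: "U i i = {} \<or> U i i = carrier G - {\<one>}"
    if U: "\<forall>i\<in>{1..2}. \<forall>j\<in>{1..2}. U i j \<subseteq> carrier G" "\<And>i. i \<in> {1..2} \<Longrightarrow> \<one> \<notin> U i i"
      "\<And>i j s. i \<in> {1..2} \<Longrightarrow> j \<in> {1..2} \<Longrightarrow> s \<in> U i j \<Longrightarrow> inv s \<in> U j i" "i \<in> {1..2}"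
    for U :: "nat \<Rightarrow> nat \<Rightarrow> 'a set" and i
  proof (rule inverse_closed_card_3[OF card])
    show "U i i \<subseteq> carrier G"
      using U(1) U(4) by blast
  qed (rule U(2)[OF U(4)], erule U(3)[OF U(4) U(4)])
  have cross: "card (U 1 2) = card (U 2 1)"
    if U: "\<forall>i\<in>{1..2}. \<forall>j\<in>{1..2}. U i j \<subseteq> carrier G"
      and U_inv: "\<And>i j s. i \<in> {1..2} \<Longrightarrow> j \<in> {1..2} \<Longrightarrow> s \<in> U i j \<Longrightarrow> inv s \<in> U j i"
    for U :: "nat \<Rightarrow> nat \<Rightarrow> 'a set"
  proof (rule bij_betw_same_card)
    have "U 1 2 \<subseteq> carrier G" "U 2 1 \<subseteq> carrier G"
      using U by auto
    then show "bij_betw (\<lambda>s. inv s) (U 1 2) (U 2 1)"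
      using U_inv[of 1 2] U_inv[of 2 1] by (intro bij_betw_byWitness[where f' = "\<lambda>s. inv s"]) auto
  qed
  have loop_card: "card (carrier G - {\<one>}) = 2"
    using card fin by simp
  have card_loop: "card (U i i) = 0 \<and> U i i = {} \<or> card (U i i) = 2 \<and> U i i = carrier G - {\<one>}"
    if "U i i = {} \<or> U i i = carrier G - {\<one>}" for U :: "nat \<Rightarrow> nat \<Rightarrow> 'a set" and i
    using that
  proof
    assume "U i i = carrier G - {\<one>}"
    then show ?thesis
      using loop_card by (simp only:) simp
  qed simp
  have S_loop: "card (S i i) = 0 \<and> S i i = {} \<or> card (S i i) = 2 \<and> S i i = carrier G - {\<one>}"
    if i: "i \<in> {1..2}" for i
    by (rule card_loop[of S i, OF loops[of S i, OF S S_one S_inv i]])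
  have S_cross: "card (S 1 2) = card (S 2 1)"
    by (rule cross[OF S S_inv])
  have T_loop: "card (T i i) = 0 \<and> T i i = {} \<or> card (T i i) = 2 \<and> T i i = carrier G - {\<one>}"
    if i: "i \<in> {1..2}" for i
    by (rule card_loop[of T i, OF loops[of T i, OF T T_one T_inv i]])
  have T_cross: "card (T 1 2) = card (T 2 1)"
    by (rule cross[OF T T_inv])
  let ?d = "\<lambda>U i. card (U i 1) + card (U i 2)"
  have deg: "?d T (snd (f u)) = ?d S (snd u)" if u: "u \<in> ?V" for u
  proof -
    have fu: "f u \<in> ?V"
      using f u by (rule bij_betw_apply)
    have "card {v \<in> ?V. (f u, v) \<in> parcs (Cay G 2 T)} = card {v \<in> ?V. (u, v) \<in> parcs (Cay G 2 S)}"
      using f arc u by (rule iso_preserves_out_degree)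
    then show ?thesis
      using out_degree_Cay_2[OF S fin, of "fst u" "snd u"] out_degree_Cay_2[OF T fin, of "fst (f u)" "snd (f u)"] u fu
      by simp
  qed
  have snd_V: "snd u = 1 \<or> snd u = 2" if "u \<in> ?V" for u
    using that by (auto simp: copies_def)
  have base: "(\<one>, 1) \<in> ?V" "(\<one>, 2) \<in> ?V"
    by (auto simp: copies_def)
  have fwd: "?d S i = ?d T 1 \<or> ?d S i = ?d T 2" if "i = 1 \<or> i = 2" for i
  proof -
    have V: "(\<one>, i) \<in> ?V"
      using that base by auto
    show ?thesis
      using deg[OF V] snd_V[OF bij_betw_apply[OF f V]] by auto
  qed
  have bwd: "?d T i = ?d S 1 \<or> ?d T i = ?d S 2" if "i = 1 \<or> i = 2" for i
  proof -
    have "(\<one>, i) \<in> f ` ?V"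
      using that base bij_betw_imp_surj_on[OF f] by auto
    then obtain u where u: "u \<in> ?V" "f u = (\<one>, i)"
      by force
    show ?thesis
      using deg[OF u(1)] snd_V[OF u(1)] u(2) by auto
  qed
  have not_ST: "\<not> (S 1 1 = carrier G - {\<one>} \<and> T 1 1 = {} \<and> T 2 2 = {})"
    using triangle_not_bipartite[OF card S T, of f] bij_betw_apply[OF f] arc by blast
  have not_TS: "\<not> (T 1 1 = carrier G - {\<one>} \<and> S 1 1 = {} \<and> S 2 2 = {})"
  proof -
    let ?g = "inv_into ?V f"
    have g: "?g v \<in> ?V" "f (?g v) = v" if "v \<in> ?V" for v
      using bij_betw_apply[OF bij_betw_inv_into[OF f] that] bij_betw_inv_into_right[OF f that] by auto
    have "(?g u, ?g v) \<in> parcs (Cay G 2 S)"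
      if "u \<in> ?V" "v \<in> ?V" "(u, v) \<in> parcs (Cay G 2 T)" for u v
      using arc[OF g(1)[OF that(1)] g(1)[OF that(2)]] g(2) that by simp
    then show ?thesis
      using triangle_not_bipartite[OF card T S, of ?g] g(1) by blast
  qed
  have match: "card (S 1 2) = card (T 1 2) \<and>
      (S 1 1 = T 1 1 \<and> S 2 2 = T 2 2 \<or> S 1 1 = T 2 2 \<and> S 2 2 = T 1 1)"
  proof -
    have num: "k = k' \<and> (p = p' \<and> q = q' \<or> p = q' \<and> q = p') \<or>
        p = 2 \<and> q = 2 \<and> p' = 0 \<and> q' = 0 \<or> p = 0 \<and> q = 0 \<and> p' = 2 \<and> q' = 2"
      if "p = 0 \<or> p = 2" "q = 0 \<or> q = 2" "p' = 0 \<or> p' = 2" "q' = 0 \<or> q' = 2"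
        "p + k = p' + k' \<or> p + k = k' + q'" "k + q = p' + k' \<or> k + q = k' + q'"
        "p' + k' = p + k \<or> p' + k' = k + q" "k' + q' = p + k \<or> k' + q' = k + q"
      for p q p' q' k k' :: nat
      using that by presburger
    have one_two: "1 \<in> {1..2::nat}" "2 \<in> {1..2::nat}"
      by auto
    have card_S: "card (S i i) = 0 \<or> card (S i i) = 2" and card_T: "card (T i i) = 0 \<or> card (T i i) = 2"
      if "i \<in> {1..2}" for i
      using S_loop[OF that] T_loop[OF that] by blast+
    have zero: "U i i = {}"
      if "card (U i i) = 0"
        "card (U i i) = 0 \<and> U i i = {} \<or> card (U i i) = 2 \<and> U i i = carrier G - {\<one>}"
      for U :: "nat \<Rightarrow> nat \<Rightarrow> 'a set" and i
      using that by (metis zero_neq_numeral)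
    have two: "U i i = carrier G - {\<one>}"
      if "card (U i i) = 2"
        "card (U i i) = 0 \<and> U i i = {} \<or> card (U i i) = 2 \<and> U i i = carrier G - {\<one>}"
      for U :: "nat \<Rightarrow> nat \<Rightarrow> 'a set" and i
      using that by (metis zero_neq_numeral)
    have eq: "S i i = T j j" if "card (S i i) = card (T j j)" "i \<in> {1..2}" "j \<in> {1..2}" for i j
      using S_loop[OF that(2)] T_loop[OF that(3)] that(1) by (metis zero_neq_numeral)
    have "card (S 1 2) = card (T 1 2) \<and>
        (card (S 1 1) = card (T 1 1) \<and> card (S 2 2) = card (T 2 2) \<or>
         card (S 1 1) = card (T 2 2) \<and> card (S 2 2) = card (T 1 1)) \<or>
        card (S 1 1) = 2 \<and> card (S 2 2) = 2 \<and> card (T 1 1) = 0 \<and> card (T 2 2) = 0 \<or>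
        card (S 1 1) = 0 \<and> card (S 2 2) = 0 \<and> card (T 1 1) = 2 \<and> card (T 2 2) = 2"
      using card_S card_T one_two fwd[of 1] fwd[of 2] bwd[of 1] bwd[of 2]
      unfolding S_cross[symmetric] T_cross[symmetric]
      by (intro num) simp_all
    then show ?thesis
      using eq one_two not_ST not_TS zero two S_loop T_loop by metis
  qed
  obtain \<pi> :: "nat \<Rightarrow> nat" where \<pi>: "bij_betw \<pi> {1..2} {1..2}"
    and \<pi>12: "\<pi> 1 = 1 \<and> \<pi> 2 = 2 \<or> \<pi> 1 = 2 \<and> \<pi> 2 = 1"
    and \<pi>_loop: "S 1 1 = T (\<pi> 1) (\<pi> 1)" "S 2 2 = T (\<pi> 2) (\<pi> 2)"
  proof -
    have two: "{1..2} = {1, 2::nat}" by auto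
    have "bij_betw id {1..2::nat} {1..2}"
      by simp
    moreover have "bij_betw (\<lambda>i. 3 - i) {1..2::nat} {1..2}"
      unfolding two by (auto simp: bij_betw_def inj_on_def)
    ultimately show thesis
      using match that[of id] that[of "\<lambda>i. 3 - i"] by auto
  qed
  have \<pi>_in: "\<pi> 1 \<in> {1..2}" "\<pi> 2 \<in> {1..2}"
    using \<pi>12 by auto
  have "card (S 1 2) = card (T (\<pi> 1) (\<pi> 2))"
    using match \<pi>12 T_cross by auto
  then obtain c where c: "c \<in> carrier G"
    and c_trans: "\<And>x. x \<in> carrier G \<Longrightarrow> x \<in> S 1 2 \<longleftrightarrow> c \<otimes> x \<in> T (\<pi> 1) (\<pi> 2)"
    using translate_if_card_eq[OF card, of "S 1 2" "T (\<pi> 1) (\<pi> 2)"] S T \<pi>_in by auto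
  have S_inv_iff: "inv s \<in> S j i \<longleftrightarrow> s \<in> S i j"
    if "i \<in> {1..2}" "j \<in> {1..2}" "s \<in> carrier G" for i j s
    using that S_inv[of i j s] S_inv[of j i "inv s"] by auto
  have T_inv_iff: "inv s \<in> T j i \<longleftrightarrow> s \<in> T i j"
    if "i \<in> {1..2}" "j \<in> {1..2}" "s \<in> carrier G" for i j s
    using that T_inv[of i j s] T_inv[of j i "inv s"] by auto
  (* Only the second copy is translated; its own connection set is invariant under conjugation. *)
  define d where "d = (\<lambda>i::nat. if i = 2 then c else \<one>)"
  have conj_one: "c \<otimes> s \<otimes> inv c = \<one> \<longleftrightarrow> s = \<one>" if "s \<in> carrier G" for s
  proof
    assume "c \<otimes> s \<otimes> inv c = \<one>"
    then have "c \<otimes> s = c"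
      using c that inv_equality[of "c \<otimes> s" "inv c"] by simp
    then show "s = \<one>"
      using c that by (simp add: r_cancel_one)
  qed (use c in simp)
  have "s \<in> S i j \<longleftrightarrow> d j \<otimes> s \<otimes> inv (d i) \<in> T (\<pi> i) (\<pi> j)"
    if ij: "i \<in> {1..2}" "j \<in> {1..2}" and s: "s \<in> carrier G" for i j s
  proof -
    consider "i = 1" "j = 1" | "i = 1" "j = 2" | "i = 2" "j = 1" | "i = 2" "j = 2"
      using ij by force
    then show ?thesis
    proof cases
      case 1
      then show ?thesis
        using s \<pi>_loop(1) by (simp add: d_def)
    next
      case 2
      then show ?thesis
        using s c c_trans[OF s] by (simp add: d_def)
    next
      case 3
      have "s \<in> S 2 1 \<longleftrightarrow> c \<otimes> inv s \<in> T (\<pi> 1) (\<pi> 2)"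
        using S_inv_iff[of 2 1 s] c_trans[of "inv s"] s by simp
      also have "\<dots> \<longleftrightarrow> inv (c \<otimes> inv s) \<in> T (\<pi> 2) (\<pi> 1)"
        using T_inv_iff[OF \<pi>_in, of "c \<otimes> inv s"] s c by simp
      also have "inv (c \<otimes> inv s) = s \<otimes> inv c"
        using s c by (simp add: inv_mult_group)
      finally show ?thesis
        using 3 s by (simp add: d_def)
    next
      case 4
      then show ?thesis
        using s c S_loop[of 2] \<pi>_loop(2) conj_one[OF s] by (auto simp: d_def)
    qed
  qed
  then show "\<exists>n\<in>R_normalizer G 2. perm_digraph n \<Gamma> = \<Sigma>"
    unfolding \<Gamma>_eq \<Sigma>_eq
    using c by (intro Cay_equivalent_by_translations[OF S T \<pi>, of d]) (auto simp: d_def)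
qed

lemma iso_integer_mod_group_3_iff: "G \<cong> integer_mod_group 3 \<longleftrightarrow> card (carrier G) = 3"
proof
  assume "G \<cong> integer_mod_group 3"
  then show "card (carrier G) = 3"
    using iso_same_card[of G "integer_mod_group 3"] by (simp add: carrier_integer_mod_group)
next
  assume card: "card (carrier G) = 3"
  have fin: "finite (carrier G)"
    using card by (metis card.infinite zero_neq_numeral)
  have "carrier G \<noteq> {\<one>}"
    using card by auto
  then obtain a where a: "a \<in> carrier G" "a \<noteq> \<one>"
    using one_closed by blast
  have "ord a dvd 3"
    using ord_dvd_group_order[OF a(1)] card by (simp add: order_def)
  moreover have "ord a \<noteq> 1"
    using a ord_eq_1 by simp
  ultimately have ord: "ord a = 3"
  proof -
    assume "ord a dvd 3" "ord a \<noteq> 1"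
    moreover have "ord a \<le> 3"
      using dvd_imp_le[OF \<open>ord a dvd 3\<close>] by simp
    moreover have "ord a \<noteq> 0" "ord a \<noteq> 2"
      using \<open>ord a dvd 3\<close> by (intro notI; simp)+
    ultimately show ?thesis
      by linarith
  qed
  let ?h = "\<lambda>i::int. a [^] i"
  have "?h \<in> hom (integer_mod_group 3) G"
  proof (rule homI)
    show "?h (x \<otimes>\<^bsub>integer_mod_group 3\<^esub> y) = ?h x \<otimes> ?h y"
      if "x \<in> carrier (integer_mod_group 3)" "y \<in> carrier (integer_mod_group 3)" for x y
    proof -
      have "a [^] ((x + y) mod 3) = a [^] (x + y)"
        using int_pow_eq[OF a(1)] ord by (simp add: mod_eq_dvd_iff[symmetric])
      then show ?thesis
        using a by (simp add: int_pow_mult)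
    qed
  qed (use a in simp)
  moreover have "bij_betw ?h (carrier (integer_mod_group 3)) (carrier G)"
  proof -
    have inj: "inj_on ?h (carrier (integer_mod_group 3))"
    proof (rule inj_onI)
      fix x y assume "x \<in> carrier (integer_mod_group 3)" "y \<in> carrier (integer_mod_group 3)" "?h x = ?h y"
      then show "x = y"
        using int_pow_eq[OF a(1), of x y] ord by (simp add: carrier_integer_mod_group) presburger
    qed
    moreover have "?h ` carrier (integer_mod_group 3) = carrier G"
      using card_image[OF inj] card a fin
      by (intro card_subset_eq) (auto simp: carrier_integer_mod_group)
    ultimately show ?thesis
      by (simp add: bij_betw_def)
  qed
  ultimately have "integer_mod_group 3 \<cong> G"
    by (intro is_isoI isoI)
  then show "G \<cong> integer_mod_group 3"
    by (rule group.iso_sym[OF group_integer_mod_group])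
qed

end

theorem theorem5p4:
  fixes G :: "('a, 'b) monoid_scheme" and m :: nat
  assumes "2 \<le> m" and "group G" and "finite (carrier G)"
  shows "(mCI_group G m \<longleftrightarrow>
            (m = 2 \<and> (trivial_group G \<or> G \<cong> integer_mod_group 3)) \<or>
            (3 \<le> m \<and> trivial_group G)) \<and>
         (mDCI_group G m \<longleftrightarrow> trivial_group G)"
proof -
  interpret group G by fact
  have triv: "trivial_group G \<longleftrightarrow> carrier G = {\<one>\<^bsub>G\<^esub>}"
    using is_group by (simp add: trivial_group_def)
  have "mDCI_group G m \<longleftrightarrow> carrier G = {\<one>\<^bsub>G\<^esub>}"
    using not_mDCI_if_nontrivial[OF assms(3,1)] mDCI_if_trivial by blast
  moreover have "mCI_group G m \<longleftrightarrow> carrier G = {\<one>\<^bsub>G\<^esub>} \<or> m = 2 \<and> card (carrier G) = 3"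
    using not_mCI_if_nontrivial[OF assms(3,1)] mDCI_if_trivial mDCI_imp_mCI mCI_if_card_3 by blast
  ultimately show ?thesis
    using assms(1) unfolding triv iso_integer_mod_group_3_iff by auto
qed

end
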